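(* Let $A$ be a finite dimensional basic algebra over a field $K$, let $Q$ be a projective $A$-module, and let $\mathfrak T$ be a functorially finite torsion class in $\mathrm{mod}A$. Put $\mathcal T_Q(\mathfrak T):=\mathrm{Fac}(Q)\ast\mathfrak T$. Then $\mathcal T_Q(\mathfrak T)=\mathrm{Fac}(Q)\ast(\mathfrak T\cap Q^\bot)$, and $\mathcal T_Q(\mathfrak T)$ is a functorially finite torsion class in $\mathrm{mod}A$.
   Context: $\mathrm{mod}A$ is the category of finitely generated left $A$-modules (so $Q\in\mathrm{mod}A$). $\mathrm{Fac}(Q)$ is the full subcategory of factor modules of finite direct sums of copies of $Q$, and $Q^\bot=\{X\in\mathrm{mod}A\mid\mathrm{Hom}_A(Q,X)=0\}$. For subcategories $\mathcal X,\mathcal Z$ of $\mathrm{mod}A$, $\mathcal X\ast\mathcal Z$ is the full subcategory of modules $Y$ for which there is a short exact sequence $0\to X\to Y\to Z\to0$ with $X\in\mathcal X$, $Z\in\mathcal Z$. A torsion class is the first member of a torsion pair in $\mathrm{mod}A$; a subcategory is functorially finite if it is both contravariantly and covariantly finite in $\mathrm{mod}A$. *)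

theory Defs
  imports "HOL-Algebra.Module" "HOL-Algebra.Ideal"
begin

section \<open>Left modules over a ring\<close>

text \<open>
  The library locale \<^locale>\<open>module\<close> is restricted to commutative rings of scalars, so left modules
  over an arbitrary ring are introduced here, on the library record of modules.  As for the
  library locale, the multiplicative fields of that record carry no meaning for a module.
\<close>

locale left_module = R?: ring R + M?: abelian_group M
  for R :: "('a, 'c) ring_scheme" and M :: "('a, 'm, 'd) module_scheme" (structure) +
  assumes lsmult_closed [simp, intro]:
      "\<lbrakk>a \<in> carrier R; x \<in> carrier M\<rbrakk> \<Longrightarrow> a \<odot>\<^bsub>M\<^esub> x \<in> carrier M"
    and lsmult_l_distr:
      "\<lbrakk>a \<in> carrier R; b \<in> carrier R; x \<in> carrier M\<rbrakk> \<Longrightarrow>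
      (a \<oplus>\<^bsub>R\<^esub> b) \<odot>\<^bsub>M\<^esub> x = a \<odot>\<^bsub>M\<^esub> x \<oplus>\<^bsub>M\<^esub> b \<odot>\<^bsub>M\<^esub> x"
    and lsmult_r_distr:
      "\<lbrakk>a \<in> carrier R; x \<in> carrier M; y \<in> carrier M\<rbrakk> \<Longrightarrow>
      a \<odot>\<^bsub>M\<^esub> (x \<oplus>\<^bsub>M\<^esub> y) = a \<odot>\<^bsub>M\<^esub> x \<oplus>\<^bsub>M\<^esub> a \<odot>\<^bsub>M\<^esub> y"
    and lsmult_assoc:
      "\<lbrakk>a \<in> carrier R; b \<in> carrier R; x \<in> carrier M\<rbrakk> \<Longrightarrow>
      (a \<otimes>\<^bsub>R\<^esub> b) \<odot>\<^bsub>M\<^esub> x = a \<odot>\<^bsub>M\<^esub> (b \<odot>\<^bsub>M\<^esub> x)"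
    and lsmult_one [simp]:
      "x \<in> carrier M \<Longrightarrow> \<one>\<^bsub>R\<^esub> \<odot>\<^bsub>M\<^esub> x = x"

definition fin_gen :: "('a, 'c) ring_scheme \<Rightarrow> ('a, 'm, 'd) module_scheme \<Rightarrow> bool"
  where "fin_gen R M \<longleftrightarrow>
    (\<exists>S. finite S \<and> S \<subseteq> carrier M \<and>
      (\<forall>x \<in> carrier M. \<exists>c \<in> S \<rightarrow> carrier R. x = (\<Oplus>\<^bsub>M\<^esub>s\<in>S. c s \<odot>\<^bsub>M\<^esub> s)))"

text \<open>Homomorphisms are only determined on the carrier; their values elsewhere are arbitrary.\<close>

definition mod_hom ::
    "('a, 'c) ring_scheme \<Rightarrow> ('a, 'm, 'd) module_scheme \<Rightarrow> ('a, 'n, 'e) module_scheme \<Rightarrow> ('m \<Rightarrow> 'n) set"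
  where "mod_hom R M N =
    {f \<in> hom (add_monoid M) (add_monoid N).
      \<forall>a \<in> carrier R. \<forall>x \<in> carrier M. f (a \<odot>\<^bsub>M\<^esub> x) = a \<odot>\<^bsub>N\<^esub> f x}"

definition mod_iso ::
    "('a, 'c) ring_scheme \<Rightarrow> ('a, 'm, 'd) module_scheme \<Rightarrow> ('a, 'n, 'e) module_scheme \<Rightarrow> bool"
  where "mod_iso R M N \<longleftrightarrow> (\<exists>f \<in> mod_hom R M N. bij_betw f (carrier M) (carrier N))"

definition hom_vanishes ::
    "('a, 'c) ring_scheme \<Rightarrow> ('a, 'm, 'd) module_scheme \<Rightarrow> ('a, 'n, 'e) module_scheme \<Rightarrow> bool"
  where "hom_vanishes R M N \<longleftrightarrow> (\<forall>f \<in> mod_hom R M N. \<forall>x \<in> carrier M. f x = \<zero>\<^bsub>N\<^esub>)"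

definition regular_module :: "('a, 'c) ring_scheme \<Rightarrow> ('a, 'a) module"
  where "regular_module R =
    \<lparr>carrier = carrier R, monoid.mult = monoid.mult R, one = \<one>\<^bsub>R\<^esub>,
     zero = \<zero>\<^bsub>R\<^esub>, add = add R, smult = monoid.mult R\<rparr>"

definition copower_module :: "nat \<Rightarrow> ('a, 'm, 'd) module_scheme \<Rightarrow> ('a, nat \<Rightarrow> 'm) module"
  where "copower_module n M =
    \<lparr>carrier = (\<Pi>\<^sub>E i\<in>{..<n}. carrier M), monoid.mult = undefined, one = undefined,
     zero = (\<lambda>i\<in>{..<n}. \<zero>\<^bsub>M\<^esub>), add = (\<lambda>x y. \<lambda>i\<in>{..<n}. x i \<oplus>\<^bsub>M\<^esub> y i),
     smult = (\<lambda>a x. \<lambda>i\<in>{..<n}. a \<odot>\<^bsub>M\<^esub> x i)\<rparr>"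

definition quotient_module :: "('a, 'm, 'd) module_scheme \<Rightarrow> 'm set \<Rightarrow> ('a, 'm set) module"
  where "quotient_module M U =
    \<lparr>carrier = a_rcosets\<^bsub>M\<^esub> U, monoid.mult = undefined, one = undefined,
     zero = U, add = set_add M,
     smult = (\<lambda>a C. \<Union>x\<in>C. U +>\<^bsub>M\<^esub> (a \<odot>\<^bsub>M\<^esub> x))\<rparr>"


section \<open>Finite dimensional basic algebras\<close>

text \<open>
  The library locale \<^locale>\<open>algebra\<close> is restricted to commutative algebras.  The record of an
  algebra holds its ring structure together with the action of the ground field.
\<close>

locale fin_dim_algebra = K: field K + A: ring A + KA: module K A
  for K :: "('k, 'c) ring_scheme" and A :: "('k, 'a, 'd) module_scheme" +
  assumes smult_mult_left:
      "\<lbrakk>k \<in> carrier K; a \<in> carrier A; b \<in> carrier A\<rbrakk> \<Longrightarrow>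
      (k \<odot>\<^bsub>A\<^esub> a) \<otimes>\<^bsub>A\<^esub> b = k \<odot>\<^bsub>A\<^esub> (a \<otimes>\<^bsub>A\<^esub> b)"
    and smult_mult_right:
      "\<lbrakk>k \<in> carrier K; a \<in> carrier A; b \<in> carrier A\<rbrakk> \<Longrightarrow>
      a \<otimes>\<^bsub>A\<^esub> (k \<odot>\<^bsub>A\<^esub> b) = k \<odot>\<^bsub>A\<^esub> (a \<otimes>\<^bsub>A\<^esub> b)"
    and fin_dim: "fin_gen K A"

definition primitive_idempotent :: "('a, 'c) ring_scheme \<Rightarrow> 'a \<Rightarrow> bool"
  where "primitive_idempotent A e \<longleftrightarrow>
    e \<in> carrier A \<and> e \<otimes>\<^bsub>A\<^esub> e = e \<and> e \<noteq> \<zero>\<^bsub>A\<^esub> \<and>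
    \<not> (\<exists>f \<in> carrier A. \<exists>g \<in> carrier A.
        f \<otimes>\<^bsub>A\<^esub> f = f \<and> g \<otimes>\<^bsub>A\<^esub> g = g \<and> f \<noteq> \<zero>\<^bsub>A\<^esub> \<and> g \<noteq> \<zero>\<^bsub>A\<^esub> \<and>
        f \<otimes>\<^bsub>A\<^esub> g = \<zero>\<^bsub>A\<^esub> \<and> g \<otimes>\<^bsub>A\<^esub> f = \<zero>\<^bsub>A\<^esub> \<and> e = f \<oplus>\<^bsub>A\<^esub> g)"

text \<open>The left ideal \<open>A e\<close>; note that \<^const>\<open>cgenideal\<close> consists of the left multiples of \<open>e\<close>.\<close>

definition idempotent_module :: "('a, 'c) ring_scheme \<Rightarrow> 'a \<Rightarrow> ('a, 'a) module"
  where "idempotent_module A e = (regular_module A) \<lparr>carrier := PIdl\<^bsub>A\<^esub> e\<rparr>"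

text \<open>
  An algebra is basic if it has a complete set of primitive orthogonal idempotents whose
  indecomposable projective modules are pairwise non-isomorphic.
\<close>

definition basic_algebra :: "('a, 'c) ring_scheme \<Rightarrow> bool"
  where "basic_algebra A \<longleftrightarrow>
    (\<exists>E. finite E \<and> (\<forall>e \<in> E. primitive_idempotent A e) \<and>
      (\<forall>e \<in> E. \<forall>f \<in> E. e \<noteq> f \<longrightarrow> e \<otimes>\<^bsub>A\<^esub> f = \<zero>\<^bsub>A\<^esub>) \<and>
      (\<Oplus>\<^bsub>A\<^esub>e\<in>E. e) = \<one>\<^bsub>A\<^esub> \<and>
      (\<forall>e \<in> E. \<forall>f \<in> E. e \<noteq> f \<longrightarrow>
        \<not> mod_iso A (idempotent_module A e) (idempotent_module A f)))"


section \<open>The category of finitely generated modules\<close>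

text \<open>
  HOL has no type of all modules.  The objects of \<open>mod A\<close> are taken to be the finitely generated
  left modules whose elements live in the type \<open>nat \<Rightarrow> 'a\<close>, where \<open>'a\<close> is the type of the elements
  of \<open>A\<close>.  Lemma \<open>mod_cat_complete\<close> shows that this loses nothing up to isomorphism.  Full
  subcategories of \<open>mod A\<close> are rendered as sets of objects.
\<close>

definition mod_cat :: "('a, 'c) ring_scheme \<Rightarrow> ('a, nat \<Rightarrow> 'a) module set"
  where "mod_cat A = {M. left_module A M \<and> fin_gen A M}"

lemma mod_hom_finsum:
  assumes M: "abelian_group M" and N: "abelian_group N" and f: "f \<in> mod_hom R M N"
    and "finite S" and "g \<in> S \<rightarrow> carrier M"
  shows "f (\<Oplus>\<^bsub>M\<^esub>s\<in>S. g s) = (\<Oplus>\<^bsub>N\<^esub>s\<in>S. f (g s))"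
proof -
  interpret M: abelian_group M by (rule M)
  interpret N: abelian_group N by (rule N)
  have hom: "f \<in> carrier M \<rightarrow> carrier N"
    "\<And>x y. \<lbrakk>x \<in> carrier M; y \<in> carrier M\<rbrakk> \<Longrightarrow> f (x \<oplus>\<^bsub>M\<^esub> y) = f x \<oplus>\<^bsub>N\<^esub> f y"
    using f by (auto simp: mod_hom_def hom_def)
  have "f \<zero>\<^bsub>M\<^esub> \<oplus>\<^bsub>N\<^esub> f \<zero>\<^bsub>M\<^esub> = f \<zero>\<^bsub>M\<^esub>"
    by (metis M.zero_closed M.l_zero hom(2))
  then have zero: "f \<zero>\<^bsub>M\<^esub> = \<zero>\<^bsub>N\<^esub>"
    by (metis M.zero_closed N.add.r_cancel_one' PiE hom(1))
  show ?thesis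
    using assms(4,5)
  proof (induction S)
    case empty
    then show ?case by (simp add: zero)
  next
    case (insert s S)
    have 1: "g \<in> S \<rightarrow> carrier M" "g s \<in> carrier M" using insert.prems by auto
    have 2: "(\<lambda>s. f (g s)) \<in> S \<rightarrow> carrier N" "f (g s) \<in> carrier N" using 1 hom(1) by auto
    show ?case
      using insert 1 2 by (simp add: hom(2))
  qed
qed

lemma mod_cat_complete:
  fixes A :: "('a, 'c) ring_scheme" and M :: "('a, 'm, 'd) module_scheme"
  assumes "left_module A M" and fg: "fin_gen A M"
  shows "\<exists>N \<in> mod_cat A. mod_iso A M N"
proof -
  interpret left_module A M by fact
  obtain S where S: "finite S" "S \<subseteq> carrier M"
    and span: "\<forall>x \<in> carrier M. \<exists>c \<in> S \<rightarrow> carrier A. x = (\<Oplus>\<^bsub>M\<^esub>s\<in>S. c s \<odot>\<^bsub>M\<^esub> s)"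
    using fg unfolding fin_gen_def by blast
  obtain c where c: "\<And>x. x \<in> carrier M \<Longrightarrow> c x \<in> S \<rightarrow> carrier A"
    "\<And>x. x \<in> carrier M \<Longrightarrow> x = (\<Oplus>\<^bsub>M\<^esub>s\<in>S. c x s \<odot>\<^bsub>M\<^esub> s)"
    using span by metis
  obtain h where h: "bij_betw h {0..<card S} S"
    using ex_bij_betw_nat_finite[OF S(1)] by blast
  define \<phi> where "\<phi> = (\<lambda>x. c x \<circ> h)"
  have inj: "inj_on \<phi> (carrier M)"
  proof (rule inj_onI)
    fix x y assume x: "x \<in> carrier M" and y: "y \<in> carrier M" and eq: "\<phi> x = \<phi> y"
    have cc: "c x s = c y s" if "s \<in> S" for s
    proof -
      have "s \<in> h ` {0..<card S}" using h that by (simp add: bij_betw_def)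
      then obtain i where "s = h i" by (rule imageE)
      then show ?thesis using fun_cong[OF eq, of i] by (simp add: \<phi>_def)
    qed
    have "(\<Oplus>\<^bsub>M\<^esub>s\<in>S. c x s \<odot>\<^bsub>M\<^esub> s) = (\<Oplus>\<^bsub>M\<^esub>s\<in>S. c y s \<odot>\<^bsub>M\<^esub> s)"
    proof (rule M.finsum_cong')
      show "(\<lambda>s. c y s \<odot>\<^bsub>M\<^esub> s) \<in> S \<rightarrow> carrier M" using S(2) c(1)[OF y] by blast
    qed (simp_all add: cc)
    then show "x = y" using c(2)[OF x] c(2)[OF y] by simp
  qed
  define \<psi> where "\<psi> = inv_into (carrier M) \<phi>"
  have \<psi>\<phi> [simp]: "\<psi> (\<phi> x) = x" if "x \<in> carrier M" for x
    using inj that by (simp add: \<psi>_def)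
  define N :: "('a, nat \<Rightarrow> 'a) module" where "N =
    \<lparr>carrier = \<phi> ` carrier M, monoid.mult = undefined, one = undefined,
     zero = \<phi> \<zero>\<^bsub>M\<^esub>, add = (\<lambda>u v. \<phi> (\<psi> u \<oplus>\<^bsub>M\<^esub> \<psi> v)),
     smult = (\<lambda>a u. \<phi> (a \<odot>\<^bsub>M\<^esub> \<psi> u))\<rparr>"
  have N_simps: "carrier N = \<phi> ` carrier M" "\<zero>\<^bsub>N\<^esub> = \<phi> \<zero>\<^bsub>M\<^esub>"
    "\<And>u v. u \<oplus>\<^bsub>N\<^esub> v = \<phi> (\<psi> u \<oplus>\<^bsub>M\<^esub> \<psi> v)"
    "\<And>a u. a \<odot>\<^bsub>N\<^esub> u = \<phi> (a \<odot>\<^bsub>M\<^esub> \<psi> u)"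
    by (simp_all add: N_def)
  have abN: "abelian_group N"
  proof (rule abelian_groupI)
    fix x assume "x \<in> carrier N"
    then obtain m where m: "m \<in> carrier M" "x = \<phi> m" by (auto simp: N_simps)
    show "\<exists>y\<in>carrier N. y \<oplus>\<^bsub>N\<^esub> x = \<zero>\<^bsub>N\<^esub>"
      using m by (intro bexI[of _ "\<phi> (\<ominus>\<^bsub>M\<^esub> m)"]) (auto simp: N_simps M.l_neg)
  qed (auto simp: N_simps M.a_assoc M.a_comm M.a_lcomm)
  have lmN: "left_module A N"
    by (intro left_module.intro left_module_axioms.intro abN R.ring_axioms)
       (auto simp: N_simps lsmult_l_distr lsmult_r_distr lsmult_assoc)
  have \<phi>_hom: "\<phi> \<in> mod_hom A M N"
    by (auto simp: mod_hom_def hom_def N_simps)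
  have "fin_gen A N"
    unfolding fin_gen_def
  proof (intro exI conjI ballI)
    show "finite (\<phi> ` S)" using S by simp
    show "\<phi> ` S \<subseteq> carrier N" using S by (auto simp: N_simps)
    fix u assume "u \<in> carrier N"
    then obtain x where x: "x \<in> carrier M" "u = \<phi> x" by (auto simp: N_simps)
    have injS: "inj_on \<phi> S" using inj S(2) by (rule inj_on_subset)
    have cl: "(\<lambda>s. c x s \<odot>\<^bsub>M\<^esub> s) \<in> S \<rightarrow> carrier M" using S(2) c(1)[OF x(1)] by auto
    have "u = \<phi> (\<Oplus>\<^bsub>M\<^esub>s\<in>S. c x s \<odot>\<^bsub>M\<^esub> s)" using c(2)[OF x(1)] x(2) by simp
    also have "\<dots> = (\<Oplus>\<^bsub>N\<^esub>s\<in>S. \<phi> (c x s \<odot>\<^bsub>M\<^esub> s))"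
      by (rule mod_hom_finsum[OF M.abelian_group_axioms abN \<phi>_hom S(1) cl])
    also have "\<dots> = (\<Oplus>\<^bsub>N\<^esub>s\<in>S. c x (\<psi> (\<phi> s)) \<odot>\<^bsub>N\<^esub> \<phi> s)"
      using cl S(2) by (intro abelian_monoid.finsum_cong'[OF abelian_group.axioms(1)[OF abN]])
        (auto simp: N_simps subset_iff Pi_iff)
    also have "\<dots> = (\<Oplus>\<^bsub>N\<^esub>t\<in>\<phi> ` S. c x (\<psi> t) \<odot>\<^bsub>N\<^esub> t)"
      using cl S(2) injS
      by (intro abelian_monoid.finsum_reindex[OF abelian_group.axioms(1)[OF abN], symmetric])
        (auto simp: N_simps subset_iff Pi_iff)
    finally have "u = (\<Oplus>\<^bsub>N\<^esub>t\<in>\<phi> ` S. c x (\<psi> t) \<odot>\<^bsub>N\<^esub> t)" .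
    moreover have "(\<lambda>t. c x (\<psi> t)) \<in> \<phi> ` S \<rightarrow> carrier A"
      using c(1)[OF x(1)] S(2) by (auto simp: subset_iff Pi_iff)
    ultimately show "\<exists>c \<in> \<phi> ` S \<rightarrow> carrier A. u = (\<Oplus>\<^bsub>N\<^esub>t\<in>\<phi> ` S. c t \<odot>\<^bsub>N\<^esub> t)" by (rule bexI)
  qed
  moreover have "mod_iso A M N"
    unfolding mod_iso_def using \<phi>_hom inj by (auto simp: bij_betw_def N_simps)
  ultimately show ?thesis using lmN by (auto simp: mod_cat_def)
qed

text \<open>For a finitely generated module, projectivity may be tested on finitely generated modules.\<close>

definition projective_mod :: "('a, 'c) ring_scheme \<Rightarrow> ('a, nat \<Rightarrow> 'a) module \<Rightarrow> bool"
  where "projective_mod A Q \<longleftrightarrow>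
    (\<forall>M \<in> mod_cat A. \<forall>N \<in> mod_cat A. \<forall>p \<in> mod_hom A M N. \<forall>f \<in> mod_hom A Q N.
      p ` carrier M = carrier N \<longrightarrow>
      (\<exists>g \<in> mod_hom A Q M. \<forall>x \<in> carrier Q. p (g x) = f x))"

definition Fac :: "('a, 'c) ring_scheme \<Rightarrow> ('a, nat \<Rightarrow> 'a) module \<Rightarrow> ('a, nat \<Rightarrow> 'a) module set"
  where "Fac A Q =
    {X \<in> mod_cat A. \<exists>n U. submodule U A (copower_module n Q) \<and>
      mod_iso A (quotient_module (copower_module n Q) U) X}"

definition right_perp :: "('a, 'c) ring_scheme \<Rightarrow> ('a, nat \<Rightarrow> 'a) module \<Rightarrow> ('a, nat \<Rightarrow> 'a) module set"
  where "right_perp A Q = {X \<in> mod_cat A. hom_vanishes A Q X}"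

definition short_exact ::
    "('a, 'm, 'd) module_scheme \<Rightarrow> ('a, 'n, 'e) module_scheme \<Rightarrow> ('a, 'p, 'f) module_scheme
      \<Rightarrow> ('m \<Rightarrow> 'n) \<Rightarrow> ('n \<Rightarrow> 'p) \<Rightarrow> bool"
  where "short_exact X Y Z f g \<longleftrightarrow>
    inj_on f (carrier X) \<and> f ` carrier X = a_kernel Y Z g \<and> g ` carrier Y = carrier Z"

definition star_product ::
    "('a, 'c) ring_scheme \<Rightarrow> ('a, nat \<Rightarrow> 'a) module set \<Rightarrow> ('a, nat \<Rightarrow> 'a) module set
      \<Rightarrow> ('a, nat \<Rightarrow> 'a) module set"
  where "star_product A \<X> \<Z> =
    {Y \<in> mod_cat A. \<exists>X \<in> \<X>. \<exists>Z \<in> \<Z>. \<exists>f \<in> mod_hom A X Y. \<exists>g \<in> mod_hom A Y Z.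
      short_exact X Y Z f g}"

definition torsion_pair ::
    "('a, 'c) ring_scheme \<Rightarrow> ('a, nat \<Rightarrow> 'a) module set \<Rightarrow> ('a, nat \<Rightarrow> 'a) module set \<Rightarrow> bool"
  where "torsion_pair A \<T> \<F> \<longleftrightarrow>
    \<T> = {X \<in> mod_cat A. \<forall>Y \<in> \<F>. hom_vanishes A X Y} \<and>
    \<F> = {Y \<in> mod_cat A. \<forall>X \<in> \<T>. hom_vanishes A X Y}"

definition torsion_class :: "('a, 'c) ring_scheme \<Rightarrow> ('a, nat \<Rightarrow> 'a) module set \<Rightarrow> bool"
  where "torsion_class A \<T> \<longleftrightarrow> (\<exists>\<F>. torsion_pair A \<T> \<F>)"

definition contravariantly_finite :: "('a, 'c) ring_scheme \<Rightarrow> ('a, nat \<Rightarrow> 'a) module set \<Rightarrow> bool"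
  where "contravariantly_finite A \<X> \<longleftrightarrow>
    (\<forall>M \<in> mod_cat A. \<exists>X \<in> \<X>. \<exists>f \<in> mod_hom A X M.
      \<forall>X' \<in> \<X>. \<forall>g \<in> mod_hom A X' M.
        \<exists>h \<in> mod_hom A X' X. \<forall>x \<in> carrier X'. f (h x) = g x)"

definition covariantly_finite :: "('a, 'c) ring_scheme \<Rightarrow> ('a, nat \<Rightarrow> 'a) module set \<Rightarrow> bool"
  where "covariantly_finite A \<X> \<longleftrightarrow>
    (\<forall>M \<in> mod_cat A. \<exists>X \<in> \<X>. \<exists>f \<in> mod_hom A M X.
      \<forall>X' \<in> \<X>. \<forall>g \<in> mod_hom A M X'.
        \<exists>h \<in> mod_hom A X X'. \<forall>x \<in> carrier M. h (f x) = g x)"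

definition functorially_finite :: "('a, 'c) ring_scheme \<Rightarrow> ('a, nat \<Rightarrow> 'a) module set \<Rightarrow> bool"
  where "functorially_finite A \<X> \<longleftrightarrow>
    \<X> \<subseteq> mod_cat A \<and> contravariantly_finite A \<X> \<and> covariantly_finite A \<X>"

definition \<T>\<^sub>Q ::
    "('a, 'c) ring_scheme \<Rightarrow> ('a, nat \<Rightarrow> 'a) module \<Rightarrow> ('a, nat \<Rightarrow> 'a) module set
      \<Rightarrow> ('a, nat \<Rightarrow> 'a) module set"
  where "\<T>\<^sub>Q A Q \<TT> = star_product A (Fac A Q) \<TT>"

end

theory Submission
  imports Defs
begin

text \<open>
  Let \<open>(\<TT>, \<FF>)\<close> be the given torsion pair and
  \<open>\<GG> = \<FF> \<inter> Q\<^sup>\<bottom>\<close>. The whole statement rests on one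
  identification: \<open>Fac Q \<ast> \<TT>\<close> is the class \<open>\<W>\<close> of all modules
  without nonzero homomorphisms into members of \<open>\<GG>\<close>. It is obtained from the cycle
  of inclusions
  \<open>Fac Q \<ast> \<TT> \<subseteq> \<W> \<subseteq> Fac Q \<ast> (\<TT> \<inter> Q\<^sup>\<bottom>) \<subseteq> Fac Q \<ast> \<TT>\<close>,
  which also gives the first claim. For the first inclusion
  (\<open>Fac_star_subset_left_perp\<close>), a homomorphism into a member of \<open>\<GG>\<close>
  kills the submodule from \<open>Fac Q\<close>, then factors through the quotient from
  \<open>\<TT>\<close> and vanishes. For the second (\<open>left_perp_subset_Fac_star\<close>),
  split \<open>X\<close> along the trace of \<open>Q\<close>, the submodule spanned by all images
  of homomorphisms \<open>Q \<rightarrow> X\<close>. The trace lies in \<open>Fac Q\<close>. As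
  \<open>Q\<close> is projective, every homomorphism from \<open>Q\<close> to a quotient
  \<open>Z\<close> of \<open>X\<close> by a submodule containing the trace lifts to
  \<open>X\<close> and hence is zero. So the image of any homomorphism from
  \<open>X / trace\<close> to a member of \<open>\<FF>\<close> belongs to \<open>\<GG>\<close>,
  being a submodule of a member of \<open>\<FF>\<close> and a quotient of \<open>X / trace\<close>;
  as \<open>X\<close> maps onto it, it is zero, and \<open>X / trace \<in> \<TT>\<close>.

  Since \<open>Q\<close> and \<open>\<TT>\<close> are contained in \<open>\<W>\<close>, the modules that receive only zero homomorphisms from
  \<open>\<W>\<close> are exactly those in \<open>\<GG>\<close>, so \<open>(\<W>, \<GG>)\<close> is a torsion pair.  A right approximation of \<open>M\<close> is
  the inclusion of the torsion submodule of \<open>M\<close>, again a trace.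

  Left approximations are the remaining point (\<open>covariantly_finite_left_perp\<close>).  Take a left
  \<open>\<TT>\<close>-approximation \<open>\<alpha> : M \<rightarrow> T\<close>, enlarge it by a free module to a surjection \<open>\<beta> : B \<rightarrow> T\<close> from
  \<open>B = M \<oplus> A\<^sup>r\<close>, and replace \<open>L = ker \<beta>\<close> by a left \<open>Fac Q\<close>-approximation of \<open>L\<close>, that is, push \<open>B\<close>
  out along it.  The result is an extension of \<open>T\<close> by a module in \<open>Fac Q\<close>.  Given \<open>g : M \<rightarrow> X\<close> with
  \<open>X \<in> \<W>\<close>, the composite with \<open>X \<rightarrow> X / trace\<close> factors through \<open>\<alpha>\<close> because \<open>X / trace \<in> \<TT>\<close>; a lift
  along the free summand extends \<open>g\<close> to \<open>B\<close> in such a way that \<open>L\<close> is mapped to the trace, and on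
  \<open>L\<close> the map factors through the \<open>Fac Q\<close>-approximation.  That approximation comes from a single
  element \<open>q\<close> of a power \<open>Q\<^sup>m\<close> (\<open>trace_approximation\<close>): if the components of \<open>q\<close> span \<open>Q\<close> over the
  ground field, every element of every trace of \<open>Q\<close> is the image of \<open>q\<close> under a homomorphism.
\<close>


section \<open>Homomorphisms and submodules\<close>

context left_module
begin

lemma smult_zero_left [simp]: "x \<in> carrier M \<Longrightarrow> \<zero>\<^bsub>R\<^esub> \<odot>\<^bsub>M\<^esub> x = \<zero>\<^bsub>M\<^esub>"
  by (metis M.add.r_cancel_one' R.l_zero R.zero_closed lsmult_closed lsmult_l_distr)

lemma smult_zero_right [simp]: "a \<in> carrier R \<Longrightarrow> a \<odot>\<^bsub>M\<^esub> \<zero>\<^bsub>M\<^esub> = \<zero>\<^bsub>M\<^esub>"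
  by (metis M.add.r_cancel_one' M.l_zero M.zero_closed lsmult_closed lsmult_r_distr)

lemma neg_eq_smult:
  assumes x: "x \<in> carrier M"
  shows "\<ominus>\<^bsub>M\<^esub> x = (\<ominus>\<^bsub>R\<^esub> \<one>\<^bsub>R\<^esub>) \<odot>\<^bsub>M\<^esub> x"
proof -
  have "(\<ominus>\<^bsub>R\<^esub> \<one>\<^bsub>R\<^esub>) \<odot>\<^bsub>M\<^esub> x \<oplus>\<^bsub>M\<^esub> x = (\<ominus>\<^bsub>R\<^esub> \<one>\<^bsub>R\<^esub> \<oplus>\<^bsub>R\<^esub> \<one>\<^bsub>R\<^esub>) \<odot>\<^bsub>M\<^esub> x"
    using x by (subst lsmult_l_distr) auto
  also have "\<dots> = \<zero>\<^bsub>M\<^esub>"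
    using x by (simp add: R.l_neg)
  finally show ?thesis
    using x by (intro M.minus_equality) auto
qed

lemma smult_finsum:
  assumes "finite S" and "a \<in> carrier R" and "f \<in> S \<rightarrow> carrier M"
  shows "a \<odot>\<^bsub>M\<^esub> (\<Oplus>\<^bsub>M\<^esub>s\<in>S. f s) = (\<Oplus>\<^bsub>M\<^esub>s\<in>S. a \<odot>\<^bsub>M\<^esub> f s)"
  using assms by (induction S) (auto simp: Pi_def lsmult_r_distr)

lemma submoduleI:
  assumes "U \<subseteq> carrier M" and "\<zero>\<^bsub>M\<^esub> \<in> U"
    and "\<And>x y. \<lbrakk>x \<in> U; y \<in> U\<rbrakk> \<Longrightarrow> x \<oplus>\<^bsub>M\<^esub> y \<in> U"
    and smult: "\<And>a x. \<lbrakk>a \<in> carrier R; x \<in> U\<rbrakk> \<Longrightarrow> a \<odot>\<^bsub>M\<^esub> x \<in> U"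
  shows "submodule U R M"
proof -
  have "\<ominus>\<^bsub>M\<^esub> x \<in> U" if "x \<in> U" for x
    using neg_eq_smult[of x] smult[of "\<ominus>\<^bsub>R\<^esub> \<one>\<^bsub>R\<^esub>" x] that assms(1) by auto
  then show ?thesis
    using assms by (auto simp: submodule_def submodule_axioms_def subgroup_def a_inv_def)
qed

lemma submodule_carrier: "submodule (carrier M) R M"
  by (rule submoduleI) auto

end

lemma submoduleD:
  assumes "submodule U R M"
  shows "U \<subseteq> carrier M" and "\<And>x. x \<in> U \<Longrightarrow> x \<in> carrier M" and "\<zero>\<^bsub>M\<^esub> \<in> U"
    and "\<And>x y. \<lbrakk>x \<in> U; y \<in> U\<rbrakk> \<Longrightarrow> x \<oplus>\<^bsub>M\<^esub> y \<in> U"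
    and "\<And>a x. \<lbrakk>a \<in> carrier R; x \<in> U\<rbrakk> \<Longrightarrow> a \<odot>\<^bsub>M\<^esub> x \<in> U"
    and "\<And>x. x \<in> U \<Longrightarrow> \<ominus>\<^bsub>M\<^esub> x \<in> U"
  using assms by (auto simp: submodule_def submodule_axioms_def subgroup_def a_inv_def)

lemma mod_homI:
  assumes "\<And>x. x \<in> carrier M \<Longrightarrow> f x \<in> carrier N"
    and "\<And>x y. \<lbrakk>x \<in> carrier M; y \<in> carrier M\<rbrakk> \<Longrightarrow> f (x \<oplus>\<^bsub>M\<^esub> y) = f x \<oplus>\<^bsub>N\<^esub> f y"
    and "\<And>a x. \<lbrakk>a \<in> carrier R; x \<in> carrier M\<rbrakk> \<Longrightarrow> f (a \<odot>\<^bsub>M\<^esub> x) = a \<odot>\<^bsub>N\<^esub> f x"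
  shows "f \<in> mod_hom R M N"
  using assms by (auto simp: mod_hom_def hom_def)

lemma mod_homD:
  assumes "f \<in> mod_hom R M N"
  shows "\<And>x. x \<in> carrier M \<Longrightarrow> f x \<in> carrier N"
    and "\<And>x y. \<lbrakk>x \<in> carrier M; y \<in> carrier M\<rbrakk> \<Longrightarrow> f (x \<oplus>\<^bsub>M\<^esub> y) = f x \<oplus>\<^bsub>N\<^esub> f y"
    and "\<And>a x. \<lbrakk>a \<in> carrier R; x \<in> carrier M\<rbrakk> \<Longrightarrow> f (a \<odot>\<^bsub>M\<^esub> x) = a \<odot>\<^bsub>N\<^esub> f x"
  using assms by (auto simp: mod_hom_def hom_def)

lemma mod_hom_zero:
  assumes "left_module R M" and "left_module R N" and f: "f \<in> mod_hom R M N"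
  shows "f \<zero>\<^bsub>M\<^esub> = \<zero>\<^bsub>N\<^esub>"
proof -
  interpret M: left_module R M by fact
  interpret N: left_module R N by fact
  have "f (\<zero>\<^bsub>R\<^esub> \<odot>\<^bsub>M\<^esub> \<zero>\<^bsub>M\<^esub>) = \<zero>\<^bsub>R\<^esub> \<odot>\<^bsub>N\<^esub> f \<zero>\<^bsub>M\<^esub>"
    by (rule mod_homD(3)[OF f]) auto
  then show ?thesis using mod_homD(1)[OF f] by simp
qed

lemma mod_hom_neg:
  assumes "left_module R M" and "left_module R N" and f: "f \<in> mod_hom R M N"
    and x: "x \<in> carrier M"
  shows "f (\<ominus>\<^bsub>M\<^esub> x) = \<ominus>\<^bsub>N\<^esub> f x"
proof -
  interpret M: left_module R M by fact
  interpret N: left_module R N by fact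
  show ?thesis
    using x mod_homD[OF f] by (simp add: M.neg_eq_smult N.neg_eq_smult)
qed

lemma mod_hom_compose:
  "\<lbrakk>f \<in> mod_hom R M N; g \<in> mod_hom R N P\<rbrakk> \<Longrightarrow> (\<lambda>x. g (f x)) \<in> mod_hom R M P"
  by (auto intro!: mod_homI simp: mod_homD)

lemma mod_hom_const_zero:
  assumes "left_module R N"
  shows "(\<lambda>x. \<zero>\<^bsub>N\<^esub>) \<in> mod_hom R M N"
proof -
  interpret N: left_module R N by fact
  show ?thesis by (rule mod_homI) auto
qed

lemma mod_hom_add:
  assumes "left_module R N" and f: "f \<in> mod_hom R M N" and g: "g \<in> mod_hom R M N"
  shows "(\<lambda>x. f x \<oplus>\<^bsub>N\<^esub> g x) \<in> mod_hom R M N"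
proof -
  interpret N: left_module R N by fact
  show ?thesis
    using mod_homD(1)[OF f] mod_homD(1)[OF g]
    by (intro mod_homI)
      (auto simp: mod_homD[OF f] mod_homD[OF g] N.lsmult_r_distr N.a_ac)
qed

text \<open>
  Equalizers serve below as an induction principle: homomorphisms that agree on generators agree
  everywhere, because the set where they agree is a submodule.  Kernels are the case of the zero
  homomorphism.
\<close>

lemma submodule_equalizer:
  assumes "left_module R M" and "left_module R N"
    and f: "f \<in> mod_hom R M N" and g: "g \<in> mod_hom R M N"
  shows "submodule {x \<in> carrier M. f x = g x} R M"
proof -
  interpret M: left_module R M by fact
  show ?thesis
    by (rule M.submoduleI)
      (auto simp: mod_homD[OF f] mod_homD[OF g] mod_hom_zero[OF assms(1,2) f]
        mod_hom_zero[OF assms(1,2) g])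
qed

lemma submodule_kernel:
  assumes "left_module R M" and "left_module R N" and f: "f \<in> mod_hom R M N"
  shows "submodule {x \<in> carrier M. f x = \<zero>\<^bsub>N\<^esub>} R M"
  using submodule_equalizer[OF assms mod_hom_const_zero[OF assms(2)]] .

lemma submodule_preimage:
  assumes "left_module R M" and "left_module R N"
    and f: "f \<in> mod_hom R M N" and U: "submodule U R N"
  shows "submodule {x \<in> carrier M. f x \<in> U} R M"
proof -
  interpret M: left_module R M by fact
  show ?thesis
    by (rule M.submoduleI)
      (auto simp: mod_homD[OF f] mod_hom_zero[OF assms(1,2) f] submoduleD[OF U])
qed

lemma submodule_image:
  assumes "left_module R M" and "left_module R N"
    and f: "f \<in> mod_hom R M N" and U: "submodule U R M"
  shows "submodule (f ` U) R N"
proof -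
  interpret N: left_module R N by fact
  show ?thesis
  proof (rule N.submoduleI)
    show "f ` U \<subseteq> carrier N" using mod_homD(1)[OF f] submoduleD(2)[OF U] by auto
    show "\<zero>\<^bsub>N\<^esub> \<in> f ` U"
      using mod_hom_zero[OF assms(1-3)] submoduleD(3)[OF U] by force
    show "x \<oplus>\<^bsub>N\<^esub> y \<in> f ` U" if xy: "x \<in> f ` U" "y \<in> f ` U" for x y
    proof -
      obtain u v where "u \<in> U" "v \<in> U" "x = f u" "y = f v" using xy by blast
      then show ?thesis
        using mod_homD(2)[OF f, of u v] submoduleD(2,4)[OF U] by force
    qed
    show "a \<odot>\<^bsub>N\<^esub> x \<in> f ` U" if a: "a \<in> carrier R" and x: "x \<in> f ` U" for a x
    proof -
      obtain u where "u \<in> U" "x = f u" using x by blast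
      then show ?thesis
        using mod_homD(3)[OF f a, of u] submoduleD(2)[OF U] submoduleD(5)[OF U a] by force
    qed
  qed
qed

lemma mod_hom_injI:
  assumes "left_module R M" and "left_module R N" and f: "f \<in> mod_hom R M N"
    and ker: "\<And>x. \<lbrakk>x \<in> carrier M; f x = \<zero>\<^bsub>N\<^esub>\<rbrakk> \<Longrightarrow> x = \<zero>\<^bsub>M\<^esub>"
  shows "inj_on f (carrier M)"
proof (rule inj_onI)
  interpret M: left_module R M by fact
  interpret N: left_module R N by fact
  fix x y assume xy: "x \<in> carrier M" "y \<in> carrier M" "f x = f y"
  then have "f (x \<oplus>\<^bsub>M\<^esub> \<ominus>\<^bsub>M\<^esub> y) = \<zero>\<^bsub>N\<^esub>"
    using mod_homD[OF f] mod_hom_neg[OF assms(1-3)] by (simp add: N.M.r_neg)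
  then have "x \<oplus>\<^bsub>M\<^esub> \<ominus>\<^bsub>M\<^esub> y = \<zero>\<^bsub>M\<^esub>" using xy by (intro ker) auto
  then show "x = y"
    using xy by (metis M.M.a_inv_closed M.M.minus_equality M.M.minus_minus)
qed

lemma mod_hom_factor_surj:
  assumes "left_module R M" and "left_module R N" and "left_module R P"
    and p: "p \<in> mod_hom R M N" and surj: "p ` carrier M = carrier N"
    and g: "g \<in> mod_hom R M P"
    and ker: "\<And>x. \<lbrakk>x \<in> carrier M; p x = \<zero>\<^bsub>N\<^esub>\<rbrakk> \<Longrightarrow> g x = \<zero>\<^bsub>P\<^esub>"
  shows "\<exists>h \<in> mod_hom R N P. \<forall>x \<in> carrier M. h (p x) = g x"
proof -
  interpret M: left_module R M by fact
  interpret N: left_module R N by fact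
  interpret P: left_module R P by fact
  define h where "h = (\<lambda>y. g (SOME x. x \<in> carrier M \<and> p x = y))"
  have wd: "g x = g y" if "x \<in> carrier M" "y \<in> carrier M" "p x = p y" for x y
  proof -
    have "g (x \<oplus>\<^bsub>M\<^esub> \<ominus>\<^bsub>M\<^esub> y) = \<zero>\<^bsub>P\<^esub>"
      using that mod_homD[OF p] mod_hom_neg[OF assms(1,2) p]
      by (intro ker) (auto simp: N.r_neg)
    then have "g x \<oplus>\<^bsub>P\<^esub> \<ominus>\<^bsub>P\<^esub> g y = \<zero>\<^bsub>P\<^esub>"
      using that mod_homD[OF g] mod_hom_neg[OF assms(1,3) g] by simp
    then show ?thesis
      using that mod_homD(1)[OF g] by (metis P.a_inv_closed P.minus_equality P.minus_minus)
  qed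
  have hp: "h (p x) = g x" if "x \<in> carrier M" for x
    unfolding h_def using that by (intro wd) (rule someI2[of _ x]; simp)+
  have "h \<in> mod_hom R N P"
  proof (rule mod_homI)
    fix y assume "y \<in> carrier N"
    then obtain x where x: "x \<in> carrier M" "y = p x" using surj by blast
    then show "h y \<in> carrier P" by (simp add: hp mod_homD(1)[OF g])
    show "h (a \<odot>\<^bsub>N\<^esub> y) = a \<odot>\<^bsub>P\<^esub> h y" if "a \<in> carrier R" for a
      using x that hp[of "a \<odot>\<^bsub>M\<^esub> x"] by (simp add: hp mod_homD[OF g] mod_homD[OF p])
    fix z assume "z \<in> carrier N"
    then obtain w where w: "w \<in> carrier M" "z = p w" using surj by blast
    show "h (y \<oplus>\<^bsub>N\<^esub> z) = h y \<oplus>\<^bsub>P\<^esub> h z"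
      using x w hp[of "x \<oplus>\<^bsub>M\<^esub> w"] by (simp add: hp mod_homD[OF g] mod_homD[OF p])
  qed
  then show ?thesis using hp by blast
qed

lemma mod_hom_factor_inj:
  assumes "left_module R M" and "left_module R N" and "left_module R P"
    and i: "i \<in> mod_hom R N P" and inj: "inj_on i (carrier N)"
    and g: "g \<in> mod_hom R M P" and img: "g ` carrier M \<subseteq> i ` carrier N"
  shows "\<exists>h \<in> mod_hom R M N. \<forall>x \<in> carrier M. i (h x) = g x"
proof -
  interpret M: left_module R M by fact
  interpret N: left_module R N by fact
  define h where "h = (\<lambda>x. inv_into (carrier N) i (g x))"
  have hN: "h x \<in> carrier N" and ih: "i (h x) = g x" if "x \<in> carrier M" for x
    using imageI[OF that, of g] img unfolding h_def
    by (blast intro: inv_into_into, blast intro: f_inv_into_f)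
  have "h \<in> mod_hom R M N"
  proof (rule mod_homI)
    show "h (x \<oplus>\<^bsub>M\<^esub> y) = h x \<oplus>\<^bsub>N\<^esub> h y" if "x \<in> carrier M" "y \<in> carrier M" for x y
      using that hN by (intro inj_onD[OF inj]) (auto simp: ih mod_homD[OF i] mod_homD[OF g])
    show "h (a \<odot>\<^bsub>M\<^esub> x) = a \<odot>\<^bsub>N\<^esub> h x" if "a \<in> carrier R" "x \<in> carrier M" for a x
      using that hN by (intro inj_onD[OF inj]) (auto simp: ih mod_homD[OF i] mod_homD[OF g])
  qed (rule hN)
  then show ?thesis using ih by blast
qed


section \<open>Spans and finite generation\<close>

definition lspan :: "('a, 'c) ring_scheme \<Rightarrow> ('a, 'm, 'd) module_scheme \<Rightarrow> 'm set \<Rightarrow> 'm set"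
  where "lspan R M S = \<Inter>{U. submodule U R M \<and> S \<subseteq> U}"

lemma lspan_least: "\<lbrakk>submodule U R M; S \<subseteq> U\<rbrakk> \<Longrightarrow> lspan R M S \<subseteq> U"
  unfolding lspan_def by blast

lemma lspan_superset: "S \<subseteq> lspan R M S"
  unfolding lspan_def by blast

lemma lspan_mono: "S \<subseteq> T \<Longrightarrow> lspan R M S \<subseteq> lspan R M T"
  unfolding lspan_def by blast

lemma submodule_lspan:
  assumes "left_module R M" and "S \<subseteq> carrier M"
  shows "submodule (lspan R M S) R M"
proof -
  interpret M: left_module R M by fact
  show ?thesis
  proof (rule M.submoduleI)
    show "lspan R M S \<subseteq> carrier M"
      by (rule lspan_least[OF M.submodule_carrier assms(2)])
  qed (auto simp: lspan_def submoduleD)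
qed

text \<open>
  Linear combinations are awkward to transport along homomorphisms.  This description by spans
  replaces them: afterwards, finite generation is only ever used by checking that a suitable
  submodule contains the generators.
\<close>

lemma fin_gen_iff_lspan:
  assumes "left_module R M"
  shows "fin_gen R M \<longleftrightarrow> (\<exists>S. finite S \<and> S \<subseteq> carrier M \<and> carrier M \<subseteq> lspan R M S)"
proof -
  interpret M: left_module R M by fact
  have comb: "(\<Oplus>\<^bsub>M\<^esub>s\<in>S. c s \<odot>\<^bsub>M\<^esub> s) \<in> U"
    if "submodule U R M" "S \<subseteq> U" "c \<in> S \<rightarrow> carrier R" "finite S" for U S c
    using that(4,2,3)
  proof (induction S)
    case empty
    then show ?case using submoduleD(3)[OF that(1)] by simp
  next
    case (insert s S)
    have "(\<lambda>s. c s \<odot>\<^bsub>M\<^esub> s) \<in> S \<rightarrow> carrier M" "c s \<odot>\<^bsub>M\<^esub> s \<in> carrier M"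
      using insert.prems submoduleD(2)[OF that(1)] by auto
    then show ?case
      using insert submoduleD(4,5)[OF that(1)] by simp
  qed
  show ?thesis
  proof
    assume "fin_gen R M"
    then obtain S where S: "finite S" "S \<subseteq> carrier M"
      "\<forall>x \<in> carrier M. \<exists>c \<in> S \<rightarrow> carrier R. x = (\<Oplus>\<^bsub>M\<^esub>s\<in>S. c s \<odot>\<^bsub>M\<^esub> s)"
      unfolding fin_gen_def by blast
    then have "carrier M \<subseteq> lspan R M S"
      using comb[OF submodule_lspan[OF assms S(2)] lspan_superset _ S(1)] by force
    then show "\<exists>S. finite S \<and> S \<subseteq> carrier M \<and> carrier M \<subseteq> lspan R M S" using S by blast
  next
    assume "\<exists>S. finite S \<and> S \<subseteq> carrier M \<and> carrier M \<subseteq> lspan R M S"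
    then obtain S where S: "finite S" "S \<subseteq> carrier M" "carrier M \<subseteq> lspan R M S" by blast
    define V where "V = {x. \<exists>c \<in> S \<rightarrow> carrier R. x = (\<Oplus>\<^bsub>M\<^esub>s\<in>S. c s \<odot>\<^bsub>M\<^esub> s)}"
    have "submodule V R M"
    proof (rule M.submoduleI)
      show "V \<subseteq> carrier M"
        using S(2) by (auto simp: V_def intro!: M.M.finsum_closed)
      have "\<zero>\<^bsub>M\<^esub> = (\<Oplus>\<^bsub>M\<^esub>s\<in>S. \<zero>\<^bsub>R\<^esub> \<odot>\<^bsub>M\<^esub> s)"
        using S(2) by (subst M.M.finsum_cong'[of _ S "\<lambda>_. \<zero>\<^bsub>M\<^esub>"]) auto
      then show "\<zero>\<^bsub>M\<^esub> \<in> V" unfolding V_def by force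
    next
      fix x y assume "x \<in> V" "y \<in> V"
      then obtain c d where c: "c \<in> S \<rightarrow> carrier R" "x = (\<Oplus>\<^bsub>M\<^esub>s\<in>S. c s \<odot>\<^bsub>M\<^esub> s)"
        and d: "d \<in> S \<rightarrow> carrier R" "y = (\<Oplus>\<^bsub>M\<^esub>s\<in>S. d s \<odot>\<^bsub>M\<^esub> s)"
        unfolding V_def by blast
      have "x \<oplus>\<^bsub>M\<^esub> y = (\<Oplus>\<^bsub>M\<^esub>s\<in>S. c s \<odot>\<^bsub>M\<^esub> s \<oplus>\<^bsub>M\<^esub> d s \<odot>\<^bsub>M\<^esub> s)"
        unfolding c(2) d(2) using c(1) d(1) S(2)
        by (intro M.M.finsum_addf[symmetric]) auto
      also have "\<dots> = (\<Oplus>\<^bsub>M\<^esub>s\<in>S. (c s \<oplus>\<^bsub>R\<^esub> d s) \<odot>\<^bsub>M\<^esub> s)"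
        using c(1) d(1) S(2)
        by (intro M.M.finsum_cong') (auto simp: Pi_iff subset_iff M.lsmult_l_distr)
      finally show "x \<oplus>\<^bsub>M\<^esub> y \<in> V"
        unfolding V_def using c(1) d(1) by (intro CollectI bexI[of _ "\<lambda>s. c s \<oplus>\<^bsub>R\<^esub> d s"]) auto
    next
      fix a x assume a: "a \<in> carrier R" and "x \<in> V"
      then obtain c where c: "c \<in> S \<rightarrow> carrier R" "x = (\<Oplus>\<^bsub>M\<^esub>s\<in>S. c s \<odot>\<^bsub>M\<^esub> s)"
        unfolding V_def by blast
      have "a \<odot>\<^bsub>M\<^esub> x = (\<Oplus>\<^bsub>M\<^esub>s\<in>S. a \<odot>\<^bsub>M\<^esub> (c s \<odot>\<^bsub>M\<^esub> s))"
        unfolding c(2) using c(1) S a by (intro M.smult_finsum) auto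
      also have "\<dots> = (\<Oplus>\<^bsub>M\<^esub>s\<in>S. (a \<otimes>\<^bsub>R\<^esub> c s) \<odot>\<^bsub>M\<^esub> s)"
        using c(1) a S(2)
        by (intro M.M.finsum_cong') (auto simp: Pi_iff subset_iff M.lsmult_assoc)
      finally show "a \<odot>\<^bsub>M\<^esub> x \<in> V"
        unfolding V_def using c(1) a by (intro CollectI bexI[of _ "\<lambda>s. a \<otimes>\<^bsub>R\<^esub> c s"]) auto
    qed
    moreover have "S \<subseteq> V"
    proof
      fix t assume t: "t \<in> S"
      have "(\<Oplus>\<^bsub>M\<^esub>s\<in>S. (if t = s then \<one>\<^bsub>R\<^esub> else \<zero>\<^bsub>R\<^esub>) \<odot>\<^bsub>M\<^esub> s)
          = (\<Oplus>\<^bsub>M\<^esub>s\<in>S. if t = s then s else \<zero>\<^bsub>M\<^esub>)"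
        using S(2) by (intro M.M.finsum_cong') auto
      also have "\<dots> = t"
        using t S by (intro M.M.finsum_singleton) auto
      finally show "t \<in> V"
        unfolding V_def by (intro CollectI bexI[of _ "\<lambda>s. if t = s then \<one>\<^bsub>R\<^esub> else \<zero>\<^bsub>R\<^esub>"]) auto
    qed
    ultimately have "carrier M \<subseteq> V"
      using lspan_least S(3) by blast
    then show "fin_gen R M"
      unfolding fin_gen_def V_def using S by blast
  qed
qed

lemma fin_gen_image:
  assumes "left_module R M" and "left_module R N"
    and f: "f \<in> mod_hom R M N" and surj: "f ` carrier M = carrier N" and "fin_gen R M"
  shows "fin_gen R N"
proof -
  obtain S where S: "finite S" "S \<subseteq> carrier M" "carrier M \<subseteq> lspan R M S"
    using \<open>fin_gen R M\<close> unfolding fin_gen_iff_lspan[OF assms(1)] by blast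
  have S': "f ` S \<subseteq> carrier N" using S(2) mod_homD(1)[OF f] by auto
  have "lspan R M S \<subseteq> {x \<in> carrier M. f x \<in> lspan R N (f ` S)}"
    using S(2) lspan_superset[of "f ` S" R N]
    by (intro lspan_least submodule_preimage[OF assms(1-3)] submodule_lspan[OF assms(2)] S') auto
  then have "carrier N \<subseteq> lspan R N (f ` S)" using S(3) unfolding surj[symmetric] by auto
  then show ?thesis using S(1) S' fin_gen_iff_lspan[OF assms(2)] by blast
qed

section \<open>Submodules, quotients and direct sums as objects\<close>

lemma left_module_submodule:
  assumes "left_module R M" and U: "submodule U R M"
  shows "left_module R (M\<lparr>carrier := U\<rparr>)"
proof -
  interpret M: left_module R M by fact
  have "abelian_group (M\<lparr>carrier := U\<rparr>)"
  proof (rule abelian_groupI)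
    fix x assume "x \<in> carrier (M\<lparr>carrier := U\<rparr>)"
    then show "\<exists>y \<in> carrier (M\<lparr>carrier := U\<rparr>). y \<oplus>\<^bsub>M\<lparr>carrier := U\<rparr>\<^esub> x = \<zero>\<^bsub>M\<lparr>carrier := U\<rparr>\<^esub>"
      using submoduleD[OF U] by (auto intro!: bexI[of _ "\<ominus>\<^bsub>M\<^esub> x"] M.M.l_neg)
  qed (use submoduleD[OF U] in \<open>auto simp: M.a_ac\<close>)
  then show ?thesis
    using submoduleD[OF U]
    by (intro left_module.intro left_module_axioms.intro M.R.ring_axioms)
      (auto simp: M.lsmult_l_distr M.lsmult_r_distr M.lsmult_assoc)
qed

lemma submodule_submodule:
  assumes "left_module R M" and U: "submodule U R M" and V: "submodule V R (M\<lparr>carrier := U\<rparr>)"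
  shows "submodule V R M"
proof -
  interpret M: left_module R M by fact
  show ?thesis
    using submoduleD[OF U] submoduleD[OF V] by (intro M.submoduleI) auto
qed

lemma lspan_submodule:
  assumes "left_module R M" and U: "submodule U R M" and "S \<subseteq> U"
  shows "lspan R (M\<lparr>carrier := U\<rparr>) S \<subseteq> lspan R M S"
proof -
  interpret MU: left_module R "M\<lparr>carrier := U\<rparr>" by (rule left_module_submodule[OF assms(1,2)])
  have S: "S \<subseteq> carrier M" using assms(3) submoduleD(1)[OF U] by (rule subset_trans)
  have "submodule (U \<inter> lspan R M S) R (M\<lparr>carrier := U\<rparr>)"
    using submoduleD[OF U] submoduleD[OF submodule_lspan[OF assms(1) S]]
    by (intro MU.submoduleI) auto
  then have "lspan R (M\<lparr>carrier := U\<rparr>) S \<subseteq> U \<inter> lspan R M S"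
    by (rule lspan_least) (use assms(3) lspan_superset[of S R M] in simp)
  then show ?thesis by blast
qed

lemma mod_iso_sym:
  assumes "left_module R M" and "left_module R N" and "mod_iso R M N"
  shows "mod_iso R N M"
proof -
  interpret M: left_module R M by fact
  obtain f where f: "f \<in> mod_hom R M N" and bij: "bij_betw f (carrier M) (carrier N)"
    using \<open>mod_iso R M N\<close> unfolding mod_iso_def by blast
  let ?g = "inv_into (carrier M) f"
  have gM: "?g y \<in> carrier M" and fg: "f (?g y) = y" if "y \<in> carrier N" for y
    using that bij by (auto simp: bij_betw_def intro: inv_into_into f_inv_into_f)
  have inj: "inj_on f (carrier M)" using bij by (simp add: bij_betw_def)
  interpret N: left_module R N by fact
  have "?g \<in> mod_hom R N M"
  proof (rule mod_homI)
    show "?g (x \<oplus>\<^bsub>N\<^esub> y) = ?g x \<oplus>\<^bsub>M\<^esub> ?g y" if "x \<in> carrier N" "y \<in> carrier N" for x y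
      using that by (intro inj_onD[OF inj]) (simp_all add: gM fg mod_homD[OF f])
    show "?g (a \<odot>\<^bsub>N\<^esub> x) = a \<odot>\<^bsub>M\<^esub> ?g x" if "a \<in> carrier R" "x \<in> carrier N" for a x
      using that by (intro inj_onD[OF inj]) (simp_all add: gM fg mod_homD[OF f])
  qed (rule gM)
  then show ?thesis
    unfolding mod_iso_def using bij_betw_inv_into[OF bij] by blast
qed

text \<open>
  Every module that occurs below is replaced by an isomorphic copy among the objects of the
  category as soon as it is known to be finitely generated.  The next two lemmas do this for
  submodules and quotients, which are thereby only ever used through their canonical maps.
\<close>

text \<open>
  A submodule or quotient is replaced by an isomorphic copy among the objects of \<open>mod A\<close> as soon as
  it is known to be finitely generated, and is afterwards only used through its canonical map.
\<close>

lemma submodule_object: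
  assumes "left_module R M" and U: "submodule U R M" and fg: "fin_gen R (M\<lparr>carrier := U\<rparr>)"
  obtains N i where "N \<in> mod_cat R" and "i \<in> mod_hom R N M"
    and "inj_on i (carrier N)" and "i ` carrier N = U"
proof -
  let ?U = "M\<lparr>carrier := U\<rparr>"
  have lU: "left_module R ?U" by (rule left_module_submodule[OF assms(1,2)])
  obtain N where N: "N \<in> mod_cat R" and iso: "mod_iso R ?U N"
    using mod_cat_complete[OF lU fg] by blast
  have "left_module R N" using N by (simp add: mod_cat_def)
  then obtain i where i: "i \<in> mod_hom R N ?U" "bij_betw i (carrier N) U"
    using mod_iso_sym[OF lU _ iso] by (auto simp: mod_iso_def)
  have "i \<in> mod_hom R N M"
    using mod_homD[OF i(1)] submoduleD(2)[OF U] by (intro mod_homI) auto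
  then show thesis using that N i(2) by (auto simp: bij_betw_def)
qed

lemma quotient_module_simps:
  "carrier (quotient_module M U) = a_rcosets\<^bsub>M\<^esub> U"
  "\<zero>\<^bsub>quotient_module M U\<^esub> = U"
  "C \<oplus>\<^bsub>quotient_module M U\<^esub> D = C <+>\<^bsub>M\<^esub> D"
  "a \<odot>\<^bsub>quotient_module M U\<^esub> C = (\<Union>x\<in>C. U +>\<^bsub>M\<^esub> (a \<odot>\<^bsub>M\<^esub> x))"
  by (simp_all add: quotient_module_def)

lemma quotient_module_facts:
  assumes "left_module R M" and U: "submodule U R M"
  shows left_module_quotient: "left_module R (quotient_module M U)"
    and quotient_map_hom: "(\<lambda>x. U +>\<^bsub>M\<^esub> x) \<in> mod_hom R M (quotient_module M U)"
    and quotient_map_surj: "(\<lambda>x. U +>\<^bsub>M\<^esub> x) ` carrier M = carrier (quotient_module M U)"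
    and quotient_map_zero_iff: "x \<in> carrier M \<Longrightarrow> U +>\<^bsub>M\<^esub> x = \<zero>\<^bsub>quotient_module M U\<^esub> \<longleftrightarrow> x \<in> U"
proof -
  interpret M: left_module R M by fact
  have sub: "subgroup U (add_monoid M)" using U by (simp add: submodule_def)
  interpret U: abelian_subgroup U M
    by (rule abelian_subgroupI3) (auto simp: additive_subgroup_def sub M.M.abelian_group_axioms)
  have carr: "carrier (quotient_module M U) = (\<lambda>x. U +>\<^bsub>M\<^esub> x) ` carrier M"
    by (auto simp: quotient_module_simps A_RCOSETS_def')
  have add: "(U +>\<^bsub>M\<^esub> x) \<oplus>\<^bsub>quotient_module M U\<^esub> (U +>\<^bsub>M\<^esub> y) = U +>\<^bsub>M\<^esub> (x \<oplus>\<^bsub>M\<^esub> y)"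
    if "x \<in> carrier M" "y \<in> carrier M" for x y
    using that by (simp add: quotient_module_simps U.a_rcos_sum)
  have smult: "a \<odot>\<^bsub>quotient_module M U\<^esub> (U +>\<^bsub>M\<^esub> x) = U +>\<^bsub>M\<^esub> (a \<odot>\<^bsub>M\<^esub> x)"
    if a: "a \<in> carrier R" and x: "x \<in> carrier M" for a x
  proof -
    have "U +>\<^bsub>M\<^esub> (a \<odot>\<^bsub>M\<^esub> y) = U +>\<^bsub>M\<^esub> (a \<odot>\<^bsub>M\<^esub> x)" if y: "y \<in> U +>\<^bsub>M\<^esub> x" for y
    proof -
      obtain u where u: "u \<in> U" "y = u \<oplus>\<^bsub>M\<^esub> x"
        using y by (auto simp: a_r_coset_def')
      then have "a \<odot>\<^bsub>M\<^esub> y = a \<odot>\<^bsub>M\<^esub> u \<oplus>\<^bsub>M\<^esub> a \<odot>\<^bsub>M\<^esub> x"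
        using a x submoduleD(2)[OF U] by (simp add: M.lsmult_r_distr)
      then have "a \<odot>\<^bsub>M\<^esub> y \<in> U +>\<^bsub>M\<^esub> (a \<odot>\<^bsub>M\<^esub> x)"
        using submoduleD(5)[OF U a u(1)] by (auto simp: a_r_coset_def')
      then show ?thesis
        using a x sub by (intro M.M.a_repr_independence[symmetric]) auto
    qed
    then show ?thesis
      unfolding quotient_module_simps by (intro UN_constant_eq[OF U.a_rcos_self[OF x]] ballI)
  qed
  have zero: "U = U +>\<^bsub>M\<^esub> \<zero>\<^bsub>M\<^esub>" using U.a_subset by simp
  have "abelian_group (quotient_module M U)"
  proof (rule abelian_groupI)
    fix C assume "C \<in> carrier (quotient_module M U)"
    then obtain x where x: "x \<in> carrier M" "C = U +>\<^bsub>M\<^esub> x" by (auto simp: carr)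
    have "(U +>\<^bsub>M\<^esub> (\<ominus>\<^bsub>M\<^esub> x)) \<oplus>\<^bsub>quotient_module M U\<^esub> C = \<zero>\<^bsub>quotient_module M U\<^esub>"
      using x U.a_subset by (simp add: add M.M.l_neg) (simp add: quotient_module_simps)
    then show "\<exists>D\<in>carrier (quotient_module M U). D \<oplus>\<^bsub>quotient_module M U\<^esub> C = \<zero>\<^bsub>quotient_module M U\<^esub>"
      using x by (auto simp: carr)
    show "\<zero>\<^bsub>quotient_module M U\<^esub> \<oplus>\<^bsub>quotient_module M U\<^esub> C = C"
      using x add[of "\<zero>\<^bsub>M\<^esub>" x] zero by (simp add: quotient_module_simps)
  next
    show "\<zero>\<^bsub>quotient_module M U\<^esub> \<in> carrier (quotient_module M U)"
      using zero by (auto simp: carr quotient_module_simps(2))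
  qed (auto simp: carr add M.M.a_ac)
  then show "left_module R (quotient_module M U)"
    by (intro left_module.intro left_module_axioms.intro M.R.ring_axioms)
      (auto simp: carr add smult M.lsmult_l_distr M.lsmult_r_distr M.lsmult_assoc)
  show "(\<lambda>x. U +>\<^bsub>M\<^esub> x) \<in> mod_hom R M (quotient_module M U)"
    by (rule mod_homI) (auto simp: carr add smult)
  show "(\<lambda>x. U +>\<^bsub>M\<^esub> x) ` carrier M = carrier (quotient_module M U)"
    by (simp add: carr)
  show "U +>\<^bsub>M\<^esub> x = \<zero>\<^bsub>quotient_module M U\<^esub> \<longleftrightarrow> x \<in> U" if "x \<in> carrier M"
    using that M.M.a_coset_join1[OF _ that sub] M.M.a_coset_join2[OF that sub]
    by (auto simp: quotient_module_simps)
qed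

lemma quotient_object:
  assumes "left_module R M" and "fin_gen R M" and U: "submodule U R M"
  obtains N p where "N \<in> mod_cat R" and "p \<in> mod_hom R M N" and "p ` carrier M = carrier N"
    and "\<And>x. x \<in> carrier M \<Longrightarrow> p x = \<zero>\<^bsub>N\<^esub> \<longleftrightarrow> x \<in> U"
proof -
  let ?Q = "quotient_module M U" and ?c = "\<lambda>x. U +>\<^bsub>M\<^esub> x"
  note c = quotient_module_facts[OF assms(1) U]
  have "fin_gen R ?Q"
    by (rule fin_gen_image[OF assms(1) c(1-3) assms(2)])
  then obtain N where N: "N \<in> mod_cat R" and "mod_iso R ?Q N"
    using mod_cat_complete[OF c(1)] by blast
  then obtain f where f: "f \<in> mod_hom R ?Q N" and bij: "bij_betw f (carrier ?Q) (carrier N)"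
    by (auto simp: mod_iso_def)
  have lN: "left_module R N" using N by (simp add: mod_cat_def)
  interpret Q: left_module R ?Q by (rule c(1))
  have "(\<lambda>x. f (?c x)) ` carrier M = carrier N"
    using bij c(3) by (metis bij_betw_def image_image)
  moreover have "f (?c x) = \<zero>\<^bsub>N\<^esub> \<longleftrightarrow> x \<in> U" if x: "x \<in> carrier M" for x
  proof -
    have "f (?c x) = \<zero>\<^bsub>N\<^esub> \<longleftrightarrow> f (?c x) = f \<zero>\<^bsub>?Q\<^esub>"
      by (simp only: mod_hom_zero[OF c(1) lN f])
    also have "\<dots> \<longleftrightarrow> ?c x = \<zero>\<^bsub>?Q\<^esub>"
      using bij_betw_imp_inj_on[OF bij] mod_homD(1)[OF c(2) x] by (intro inj_on_eq_iff) auto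
    finally show ?thesis using c(4)[OF x] by blast
  qed
  ultimately show thesis
    using that[OF N mod_hom_compose[OF c(2) f]] by blast
qed

definition prod_module ::
    "('a, 'm, 'd) module_scheme \<Rightarrow> ('a, 'n, 'e) module_scheme \<Rightarrow> ('a, 'm \<times> 'n) module"
  where "prod_module M N =
    \<lparr>carrier = carrier M \<times> carrier N, monoid.mult = undefined, one = undefined,
     zero = (\<zero>\<^bsub>M\<^esub>, \<zero>\<^bsub>N\<^esub>), add = (\<lambda>x y. (fst x \<oplus>\<^bsub>M\<^esub> fst y, snd x \<oplus>\<^bsub>N\<^esub> snd y)),
     smult = (\<lambda>a x. (a \<odot>\<^bsub>M\<^esub> fst x, a \<odot>\<^bsub>N\<^esub> snd x))\<rparr>"

lemma prod_module_simps [simp]: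
  "carrier (prod_module M N) = carrier M \<times> carrier N"
  "\<zero>\<^bsub>prod_module M N\<^esub> = (\<zero>\<^bsub>M\<^esub>, \<zero>\<^bsub>N\<^esub>)"
  "x \<oplus>\<^bsub>prod_module M N\<^esub> y = (fst x \<oplus>\<^bsub>M\<^esub> fst y, snd x \<oplus>\<^bsub>N\<^esub> snd y)"
  "a \<odot>\<^bsub>prod_module M N\<^esub> x = (a \<odot>\<^bsub>M\<^esub> fst x, a \<odot>\<^bsub>N\<^esub> snd x)"
  by (simp_all add: prod_module_def)

lemma left_module_prod:
  assumes "left_module R M" and "left_module R N"
  shows "left_module R (prod_module M N)"
proof -
  interpret M: left_module R M by fact
  interpret N: left_module R N by fact
  have "abelian_group (prod_module M N)"
  proof (rule abelian_groupI)
    fix x assume "x \<in> carrier (prod_module M N)"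
    then show "\<exists>y\<in>carrier (prod_module M N). y \<oplus>\<^bsub>prod_module M N\<^esub> x = \<zero>\<^bsub>prod_module M N\<^esub>"
      by (intro bexI[of _ "(\<ominus>\<^bsub>M\<^esub> fst x, \<ominus>\<^bsub>N\<^esub> snd x)"]) (auto simp: M.M.l_neg N.M.l_neg)
  qed (auto simp: M.M.a_ac N.M.a_ac)
  then show ?thesis
    by (intro left_module.intro left_module_axioms.intro M.R.ring_axioms)
      (auto simp: M.lsmult_l_distr M.lsmult_r_distr M.lsmult_assoc
        N.lsmult_l_distr N.lsmult_r_distr N.lsmult_assoc)
qed

lemma prod_inl_hom:
  assumes "left_module R N"
  shows "(\<lambda>x. (x, \<zero>\<^bsub>N\<^esub>)) \<in> mod_hom R M (prod_module M N)"
proof -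
  interpret N: left_module R N by fact
  show ?thesis by (rule mod_homI) auto
qed

lemma prod_inr_hom:
  assumes "left_module R M"
  shows "(\<lambda>y. (\<zero>\<^bsub>M\<^esub>, y)) \<in> mod_hom R N (prod_module M N)"
proof -
  interpret M: left_module R M by fact
  show ?thesis by (rule mod_homI) auto
qed

lemma prod_case_hom:
  assumes "left_module R P" and "f \<in> mod_hom R M P" and "g \<in> mod_hom R N P"
  shows "(\<lambda>x. f (fst x) \<oplus>\<^bsub>P\<^esub> g (snd x)) \<in> mod_hom R (prod_module M N) P"
proof -
  have fst: "fst \<in> mod_hom R (prod_module M N) M" and snd: "snd \<in> mod_hom R (prod_module M N) N"
    by (auto intro: mod_homI)
  show ?thesis
    by (rule mod_hom_add[OF assms(1) mod_hom_compose[OF fst assms(2)] mod_hom_compose[OF snd assms(3)]])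
qed

lemma fin_gen_prod:
  assumes "left_module R M" and "left_module R N" and "fin_gen R M" and "fin_gen R N"
  shows "fin_gen R (prod_module M N)"
proof -
  interpret M: left_module R M by fact
  interpret N: left_module R N by fact
  let ?i = "\<lambda>x. (x, \<zero>\<^bsub>N\<^esub>)" and ?j = "\<lambda>y. (\<zero>\<^bsub>M\<^esub>, y)"
  obtain S where S: "finite S" "S \<subseteq> carrier M" "carrier M \<subseteq> lspan R M S"
    using \<open>fin_gen R M\<close> unfolding fin_gen_iff_lspan[OF assms(1)] by blast
  obtain T where T: "finite T" "T \<subseteq> carrier N" "carrier N \<subseteq> lspan R N T"
    using \<open>fin_gen R N\<close> unfolding fin_gen_iff_lspan[OF assms(2)] by blast
  have lP: "left_module R (prod_module M N)" by (rule left_module_prod[OF assms(1,2)])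
  let ?G = "?i ` S \<union> ?j ` T"
  have G: "?G \<subseteq> carrier (prod_module M N)" using S T by auto
  let ?L = "lspan R (prod_module M N) ?G"
  note L = submodule_lspan[OF lP G]
  have GL: "?G \<subseteq> ?L" by (rule lspan_superset)
  have "lspan R M S \<subseteq> {x \<in> carrier M. ?i x \<in> ?L}"
    using GL S(2)
    by (intro lspan_least submodule_preimage[OF assms(1) lP prod_inl_hom[OF assms(2)] L]) auto
  moreover have "lspan R N T \<subseteq> {y \<in> carrier N. ?j y \<in> ?L}"
    using GL T(2)
    by (intro lspan_least submodule_preimage[OF assms(2) lP prod_inr_hom[OF assms(1)] L]) auto
  ultimately have "(x, y) \<in> ?L" if "x \<in> carrier M" "y \<in> carrier N" for x y
    using submoduleD(4)[OF L, of "?i x" "?j y"] that S(3) T(3) by auto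
  then show ?thesis
    unfolding fin_gen_iff_lspan[OF lP] using G S(1) T(1) by (intro exI[of _ ?G]) auto
qed

lemma copower_module_simps:
  "carrier (copower_module n M) = (\<Pi>\<^sub>E i\<in>{..<n}. carrier M)"
  "\<zero>\<^bsub>copower_module n M\<^esub> = (\<lambda>i\<in>{..<n}. \<zero>\<^bsub>M\<^esub>)"
  "x \<oplus>\<^bsub>copower_module n M\<^esub> y = (\<lambda>i\<in>{..<n}. x i \<oplus>\<^bsub>M\<^esub> y i)"
  "a \<odot>\<^bsub>copower_module n M\<^esub> x = (\<lambda>i\<in>{..<n}. a \<odot>\<^bsub>M\<^esub> x i)"
  by (simp_all add: copower_module_def)

lemma left_module_copower:
  assumes "left_module R M"
  shows "left_module R (copower_module n M)"
proof -
  interpret M: left_module R M by fact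
  note simps = copower_module_simps PiE_iff restrict_def extensional_def
  have "abelian_group (copower_module n M)"
  proof (rule abelian_groupI)
    fix x assume "x \<in> carrier (copower_module n M)"
    then show "\<exists>y\<in>carrier (copower_module n M). y \<oplus>\<^bsub>copower_module n M\<^esub> x = \<zero>\<^bsub>copower_module n M\<^esub>"
      by (intro bexI[of _ "\<lambda>i\<in>{..<n}. \<ominus>\<^bsub>M\<^esub> x i"]) (auto simp: simps M.M.l_neg)
  qed (auto simp: simps M.M.a_ac fun_eq_iff)
  then show ?thesis
    by (intro left_module.intro left_module_axioms.intro M.R.ring_axioms)
      (auto simp: simps M.lsmult_l_distr M.lsmult_r_distr M.lsmult_assoc fun_eq_iff)
qed

text \<open>
  The copower is handled through its universal property: \<open>copower_submodule_eq\<close> says that it is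
  generated by the images of the injections, \<open>copower_hom_ex\<close> that homomorphisms out of it may be
  prescribed on them.
\<close>

definition copower_inj :: "nat \<Rightarrow> ('a, 'm, 'd) module_scheme \<Rightarrow> nat \<Rightarrow> 'm \<Rightarrow> nat \<Rightarrow> 'm"
  where "copower_inj n M i x = (\<lambda>j\<in>{..<n}. if j = i then x else \<zero>\<^bsub>M\<^esub>)"

lemma copower_inj_hom:
  assumes "left_module R M"
  shows "copower_inj n M i \<in> mod_hom R M (copower_module n M)"
proof -
  interpret M: left_module R M by fact
  show ?thesis
    by (rule mod_homI) (auto simp: copower_module_simps copower_inj_def)
qed

lemma copower_proj_hom: "i < n \<Longrightarrow> (\<lambda>x. x i) \<in> mod_hom R (copower_module n M) M"
  by (rule mod_homI) (auto simp: copower_module_simps)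

lemma copower_tuple_hom:
  assumes "\<And>i. i < n \<Longrightarrow> \<psi> i \<in> mod_hom R M N"
  shows "(\<lambda>x. \<lambda>i\<in>{..<n}. \<psi> i x) \<in> mod_hom R M (copower_module n N)"
  by (rule mod_homI) (auto simp: copower_module_simps fun_eq_iff mod_homD[OF assms])

lemma copower_submodule_eq:
  assumes "left_module R M" and U: "submodule U R (copower_module n M)"
    and inj: "\<And>i x. \<lbrakk>i < n; x \<in> carrier M\<rbrakk> \<Longrightarrow> copower_inj n M i x \<in> U"
  shows "carrier (copower_module n M) \<subseteq> U"
proof
  interpret M: left_module R M by fact
  fix x assume x: "x \<in> carrier (copower_module n M)"
  then have xi: "x i \<in> carrier M" if "i < n" for i
    using that by (auto simp: copower_module_simps)
  \<comment> \<open>\<open>t k\<close> truncates \<open>x\<close> after its first \<open>k\<close> components; it arises from \<open>t 0 = 0\<close> by adding one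
    injected component at a time\<close>
  define t where "t = (\<lambda>k. \<lambda>i\<in>{..<n}. if i < k then x i else \<zero>\<^bsub>M\<^esub>)"
  have "k \<le> n \<Longrightarrow> t k \<in> U" for k
  proof (induction k)
    case 0
    have "t 0 = \<zero>\<^bsub>copower_module n M\<^esub>"
      by (simp add: t_def copower_module_simps fun_eq_iff)
    then show ?case using submoduleD(3)[OF U] by simp
  next
    case (Suc k)
    have "t (Suc k) = t k \<oplus>\<^bsub>copower_module n M\<^esub> copower_inj n M k (x k)"
      using xi by (auto simp: t_def copower_module_simps copower_inj_def fun_eq_iff less_Suc_eq)
    then show ?case using Suc inj[of k] xi submoduleD(4)[OF U] by simp
  qed
  moreover have "t n = x"
    using x by (auto simp: t_def copower_module_simps fun_eq_iff PiE_iff extensional_def)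
  ultimately show "x \<in> U" by force
qed

lemma hom_vanishesD:
  "\<lbrakk>hom_vanishes R M N; f \<in> mod_hom R M N; x \<in> carrier M\<rbrakk> \<Longrightarrow> f x = \<zero>\<^bsub>N\<^esub>"
  unfolding hom_vanishes_def by blast

lemma hom_vanishes_copower:
  assumes "left_module R M" and "left_module R N" and van: "hom_vanishes R M N"
  shows "hom_vanishes R (copower_module n M) N"
  unfolding hom_vanishes_def
proof (intro ballI)
  fix f x assume f: "f \<in> mod_hom R (copower_module n M) N" and x: "x \<in> carrier (copower_module n M)"
  note lC = left_module_copower[OF assms(1), of n]
  note inj = copower_inj_hom[OF assms(1), of n]
  have "carrier (copower_module n M) \<subseteq> {x \<in> carrier (copower_module n M). f x = \<zero>\<^bsub>N\<^esub>}"
    using mod_homD(1)[OF inj] hom_vanishesD[OF van mod_hom_compose[OF inj f]]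
    by (intro copower_submodule_eq[OF assms(1) submodule_kernel[OF lC assms(2) f]]) simp_all
  then show "f x = \<zero>\<^bsub>N\<^esub>" using x by blast
qed

lemma copower_hom_ex:
  assumes "left_module R M" and "left_module R N"
    and \<phi>: "\<And>i. i < n \<Longrightarrow> \<phi> i \<in> mod_hom R M N"
  obtains \<Phi> where "\<Phi> \<in> mod_hom R (copower_module n M) N"
    and "\<And>i x. \<lbrakk>i < n; x \<in> carrier M\<rbrakk> \<Longrightarrow> \<Phi> (copower_inj n M i x) = \<phi> i x"
proof -
  interpret M: left_module R M by fact
  interpret N: left_module R N by fact
  \<comment> \<open>adding the homomorphisms \<open>\<phi> i\<close> of the components one by one avoids finite sums of homomorphisms\<close>
  have "\<exists>\<Phi> \<in> mod_hom R (copower_module n M) N. \<forall>i<n. \<forall>x \<in> carrier M.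
      \<Phi> (copower_inj n M i x) = (if i < k then \<phi> i x else \<zero>\<^bsub>N\<^esub>)" if "k \<le> n" for k
    using that
  proof (induction k)
    case 0
    then show ?case using mod_hom_const_zero[OF assms(2)] by force
  next
    case (Suc k)
    then obtain \<Phi> where \<Phi>: "\<Phi> \<in> mod_hom R (copower_module n M) N"
      "\<And>i x. \<lbrakk>i < n; x \<in> carrier M\<rbrakk> \<Longrightarrow> \<Phi> (copower_inj n M i x) = (if i < k then \<phi> i x else \<zero>\<^bsub>N\<^esub>)"
      by force
    have k: "k < n" using Suc by simp
    have "(\<lambda>x. \<Phi> x \<oplus>\<^bsub>N\<^esub> \<phi> k (x k)) \<in> mod_hom R (copower_module n M) N"
      by (intro mod_hom_add[OF assms(2)] \<Phi>(1) mod_hom_compose[OF copower_proj_hom[OF k] \<phi>[OF k]])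
    moreover have "\<forall>i<n. \<forall>x \<in> carrier M. \<Phi> (copower_inj n M i x) \<oplus>\<^bsub>N\<^esub> \<phi> k (copower_inj n M i x k)
        = (if i < Suc k then \<phi> i x else \<zero>\<^bsub>N\<^esub>)"
    proof (intro allI impI ballI)
      fix i x assume i: "i < n" and x: "x \<in> carrier M"
      show "\<Phi> (copower_inj n M i x) \<oplus>\<^bsub>N\<^esub> \<phi> k (copower_inj n M i x k)
          = (if i < Suc k then \<phi> i x else \<zero>\<^bsub>N\<^esub>)"
        using k x \<Phi>(2)[OF i x] mod_hom_zero[OF assms(1,2) \<phi>[OF k]]
          mod_homD(1)[OF \<phi>[OF i] x] mod_homD(1)[OF \<phi>[OF k] x]
        by (auto simp: copower_inj_def less_Suc_eq)
    qed
    ultimately show ?case by - (rule bexI)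
  qed
  from this[of n] show thesis using that by fastforce
qed

lemma fin_gen_copower:
  assumes "left_module R M" and "fin_gen R M"
  shows "fin_gen R (copower_module n M)"
proof -
  interpret M: left_module R M by fact
  obtain S where S: "finite S" "S \<subseteq> carrier M" "carrier M \<subseteq> lspan R M S"
    using \<open>fin_gen R M\<close> unfolding fin_gen_iff_lspan[OF assms(1)] by blast
  have lC: "left_module R (copower_module n M)" by (rule left_module_copower[OF assms(1)])
  let ?G = "\<Union>i<n. copower_inj n M i ` S"
  have G: "?G \<subseteq> carrier (copower_module n M)"
    using S(2) mod_homD(1)[OF copower_inj_hom[OF assms(1)]] by auto
  let ?L = "lspan R (copower_module n M) ?G"
  note L = submodule_lspan[OF lC G]
  have GL: "?G \<subseteq> ?L" by (rule lspan_superset)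
  have "lspan R M S \<subseteq> {x \<in> carrier M. copower_inj n M i x \<in> ?L}" if "i < n" for i
    using GL S(2) that
    by (intro lspan_least submodule_preimage[OF assms(1) lC copower_inj_hom[OF assms(1)] L]) auto
  then have "carrier (copower_module n M) \<subseteq> ?L"
    using S(3) by (intro copower_submodule_eq[OF assms(1) L]) auto
  then show ?thesis
    unfolding fin_gen_iff_lspan[OF lC] using G S(1) by (intro exI[of _ ?G]) auto
qed

lemma regular_module_simps [simp]:
  "carrier (regular_module R) = carrier R"
  "\<zero>\<^bsub>regular_module R\<^esub> = \<zero>\<^bsub>R\<^esub>"
  "x \<oplus>\<^bsub>regular_module R\<^esub> y = x \<oplus>\<^bsub>R\<^esub> y"
  "a \<odot>\<^bsub>regular_module R\<^esub> x = a \<otimes>\<^bsub>R\<^esub> x"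
  by (simp_all add: regular_module_def)

lemma left_module_regular:
  assumes "ring R"
  shows "left_module R (regular_module R)"
proof -
  interpret ring R by fact
  have "abelian_group (regular_module R)"
  proof (rule abelian_groupI)
    fix x assume "x \<in> carrier (regular_module R)"
    then show "\<exists>y\<in>carrier (regular_module R). y \<oplus>\<^bsub>regular_module R\<^esub> x = \<zero>\<^bsub>regular_module R\<^esub>"
      by (intro bexI[of _ "\<ominus>\<^bsub>R\<^esub> x"]) (auto simp: l_neg)
  qed (auto simp: a_ac)
  then show ?thesis
    by (intro left_module.intro left_module_axioms.intro ring_axioms)
      (auto simp: l_distr r_distr m_assoc)
qed

lemma fin_gen_regular:
  assumes "ring R"
  shows "fin_gen R (regular_module R)"
proof -
  interpret ring R by fact
  note l = left_module_regular[OF assms]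
  interpret l: left_module R "regular_module R" by (rule l)
  have "x \<in> U" if U: "submodule U R (regular_module R)" "\<one>\<^bsub>R\<^esub> \<in> U" and x: "x \<in> carrier R" for U x
    using submoduleD(5)[OF U(1) x U(2)] x by simp
  then show ?thesis
    unfolding fin_gen_iff_lspan[OF l] by (intro exI[of _ "{\<one>\<^bsub>R\<^esub>}"]) (auto simp: lspan_def)
qed

lemma regular_module_hom:
  assumes "left_module R M" and x: "x \<in> carrier M"
  shows "(\<lambda>a. a \<odot>\<^bsub>M\<^esub> x) \<in> mod_hom R (regular_module R) M"
proof -
  interpret M: left_module R M by fact
  show ?thesis
    using x by (intro mod_homI) (auto simp: M.lsmult_l_distr M.lsmult_assoc)
qed

section \<open>Finite dimensional algebras are noetherian\<close>

text \<open>
  Linear algebra over the ground field is what makes submodules of finitely generated modules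
  finitely generated.  The induction removes one spanning vector \<open>s\<close>: if \<open>U\<close> is not already
  contained in the span of the others, one vector \<open>n \<in> U\<close> with a nonzero coefficient at \<open>s\<close> reduces
  the rest of \<open>U\<close> to its intersection with that span.
\<close>

lemma subspace_fin_gen:
  assumes "field K" and "left_module K V" and "finite S" and "S \<subseteq> carrier V"
    and "submodule U K V" and "U \<subseteq> lspan K V S"
  shows "\<exists>T. finite T \<and> T \<subseteq> U \<and> U \<subseteq> lspan K V T"
proof -
  interpret K: field K by fact
  interpret V: left_module K V by fact
  show ?thesis
    using assms(3-6)
  proof (induction S arbitrary: U)
    case empty
    then show ?case by blast
  next
    case (insert s S)
    have S: "S \<subseteq> carrier V" and s: "s \<in> carrier V" using insert.prems by auto
    note U = submoduleD[OF insert.prems(2)]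
    let ?L = "lspan K V S"
    have subL: "submodule ?L K V" by (rule submodule_lspan[OF assms(2) S])
    note L = submoduleD[OF subL]
    define E where "E = {k \<odot>\<^bsub>V\<^esub> s \<oplus>\<^bsub>V\<^esub> u | k u. k \<in> carrier K \<and> u \<in> ?L}"
    have EI: "k \<odot>\<^bsub>V\<^esub> s \<oplus>\<^bsub>V\<^esub> u \<in> E" if "k \<in> carrier K" "u \<in> ?L" for k u
      using that unfolding E_def by blast
    have "submodule E K V"
    proof (rule V.submoduleI)
      show "E \<subseteq> carrier V" using s L(2) by (auto simp: E_def)
      show "\<zero>\<^bsub>V\<^esub> \<in> E" using EI[OF K.zero_closed L(3)] s by simp
    next
      fix x y assume "x \<in> E" "y \<in> E"
      then obtain k u l v where x: "k \<in> carrier K" "u \<in> ?L" "x = k \<odot>\<^bsub>V\<^esub> s \<oplus>\<^bsub>V\<^esub> u"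
        and y: "l \<in> carrier K" "v \<in> ?L" "y = l \<odot>\<^bsub>V\<^esub> s \<oplus>\<^bsub>V\<^esub> v"
        unfolding E_def by blast
      have "x \<oplus>\<^bsub>V\<^esub> y = (k \<oplus>\<^bsub>K\<^esub> l) \<odot>\<^bsub>V\<^esub> s \<oplus>\<^bsub>V\<^esub> (u \<oplus>\<^bsub>V\<^esub> v)"
        using x y s L(2) by (simp add: V.lsmult_l_distr V.M.a_ac)
      then show "x \<oplus>\<^bsub>V\<^esub> y \<in> E"
        unfolding E_def using x y L(4) by blast
    next
      fix a x assume a: "a \<in> carrier K" and "x \<in> E"
      then obtain k u where x: "k \<in> carrier K" "u \<in> ?L" "x = k \<odot>\<^bsub>V\<^esub> s \<oplus>\<^bsub>V\<^esub> u"
        unfolding E_def by blast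
      have "a \<odot>\<^bsub>V\<^esub> x = (a \<otimes>\<^bsub>K\<^esub> k) \<odot>\<^bsub>V\<^esub> s \<oplus>\<^bsub>V\<^esub> a \<odot>\<^bsub>V\<^esub> u"
        using x a s L(2) by (simp add: V.lsmult_r_distr V.lsmult_assoc)
      then show "a \<odot>\<^bsub>V\<^esub> x \<in> E"
        unfolding E_def using x a L(5) by blast
    qed
    moreover have "insert s S \<subseteq> E"
    proof -
      have "s \<in> E" using EI[OF K.one_closed L(3)] s by simp
      moreover have "t \<in> E" if "t \<in> S" for t
      proof -
        have "t \<in> ?L" by (rule subsetD[OF lspan_superset that])
        then show ?thesis using EI[OF K.zero_closed, of t] s L(2) by simp
      qed
      ultimately show ?thesis by blast
    qed
    ultimately have UE: "U \<subseteq> E" by (rule subset_trans[OF insert.prems(3) lspan_least])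
    show ?case
    proof (cases "U \<subseteq> ?L")
      case True
      then show ?thesis using insert.IH[OF S insert.prems(2)] by blast
    next
      case False
      then obtain n where n: "n \<in> U" "n \<notin> ?L" by blast
      obtain c u where cu: "c \<in> carrier K" "u \<in> ?L" "n = c \<odot>\<^bsub>V\<^esub> s \<oplus>\<^bsub>V\<^esub> u"
        using UE n(1) unfolding E_def by blast
      have "c \<noteq> \<zero>\<^bsub>K\<^esub>" using cu n(2) s L(2) by auto
      then have c: "inv\<^bsub>K\<^esub> c \<in> carrier K" "inv\<^bsub>K\<^esub> c \<otimes>\<^bsub>K\<^esub> c = \<one>\<^bsub>K\<^esub>"
        using cu(1) by (auto simp: K.field_Units)
      have "submodule (U \<inter> ?L) K V"
        using U L by (intro V.submoduleI) auto
      then obtain T where T: "finite T" "T \<subseteq> U \<inter> ?L" "U \<inter> ?L \<subseteq> lspan K V T"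
        using insert.IH[OF S] by blast
      have nT: "insert n T \<subseteq> carrier V" using n(1) T(2) U(2) by auto
      note LT = submoduleD[OF submodule_lspan[OF assms(2) nT]]
      have "y \<in> lspan K V (insert n T)" if y: "y \<in> U" for y
      proof -
        obtain k v where kv: "k \<in> carrier K" "v \<in> ?L" "y = k \<odot>\<^bsub>V\<^esub> s \<oplus>\<^bsub>V\<^esub> v"
          using UE y unfolding E_def by blast
        \<comment> \<open>subtracting \<open>d n\<close> from \<open>y\<close> cancels the multiple of \<open>s\<close>\<close>
        define d where "d = k \<otimes>\<^bsub>K\<^esub> inv\<^bsub>K\<^esub> c"
        have d: "d \<in> carrier K" using kv c by (simp add: d_def)
        have "d \<otimes>\<^bsub>K\<^esub> c = k" using kv c cu by (simp add: d_def K.m_assoc)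
        then have dn: "d \<odot>\<^bsub>V\<^esub> n = k \<odot>\<^bsub>V\<^esub> s \<oplus>\<^bsub>V\<^esub> d \<odot>\<^bsub>V\<^esub> u"
          using d cu s L(2) by (simp add: V.lsmult_r_distr V.lsmult_assoc[symmetric])
        define z where "z = v \<oplus>\<^bsub>V\<^esub> \<ominus>\<^bsub>V\<^esub> (d \<odot>\<^bsub>V\<^esub> u)"
        have zL: "z \<in> ?L" using kv cu d L(4-6) by (simp add: z_def)
        have y_eq: "y = z \<oplus>\<^bsub>V\<^esub> d \<odot>\<^bsub>V\<^esub> n"
        proof -
          have "z \<oplus>\<^bsub>V\<^esub> d \<odot>\<^bsub>V\<^esub> n = (k \<odot>\<^bsub>V\<^esub> s \<oplus>\<^bsub>V\<^esub> v) \<oplus>\<^bsub>V\<^esub> (\<ominus>\<^bsub>V\<^esub> (d \<odot>\<^bsub>V\<^esub> u) \<oplus>\<^bsub>V\<^esub> d \<odot>\<^bsub>V\<^esub> u)"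
            unfolding dn z_def using kv(1) L(2)[OF kv(2)] L(2)[OF cu(2)] d s
            by (simp only: V.M.a_ac V.lsmult_closed V.M.a_closed V.M.a_inv_closed)
          then show ?thesis using kv L(2)[OF kv(2)] L(2)[OF cu(2)] d s by (simp add: V.M.l_neg)
        qed
        have "z = y \<oplus>\<^bsub>V\<^esub> \<ominus>\<^bsub>V\<^esub> (d \<odot>\<^bsub>V\<^esub> n)"
          unfolding y_eq using L(2)[OF zL] U(2)[OF n(1)] d by (simp add: V.M.a_assoc V.M.r_neg)
        then have "z \<in> U" using U(4-6) y n(1) d by simp
        then have "z \<in> lspan K V T" using zL T(3) by blast
        then have "z \<in> lspan K V (insert n T)" using lspan_mono[of T "insert n T" K V] by blast
        moreover have "n \<in> lspan K V (insert n T)" by (rule subsetD[OF lspan_superset]) simp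
        ultimately show ?thesis unfolding y_eq using d LT(4,5) by simp
      qed
      then show ?thesis using T n(1) by (intro exI[of _ "insert n T"]) auto
    qed
  qed
qed

text \<open>
  The ground field acts on an \<open>A\<close>-module through the central elements \<open>k \<cdot> 1\<close> of \<open>A\<close>.
\<close>

definition restrict_scalars ::
    "('k, 'a, 'd) module_scheme \<Rightarrow> ('a, 'm, 'e) module_scheme \<Rightarrow> ('k, 'm) module"
  where "restrict_scalars A M =
    \<lparr>carrier = carrier M, monoid.mult = undefined, one = undefined, zero = \<zero>\<^bsub>M\<^esub>, add = add M,
     smult = (\<lambda>k x. (k \<odot>\<^bsub>A\<^esub> \<one>\<^bsub>A\<^esub>) \<odot>\<^bsub>M\<^esub> x)\<rparr>"

lemma restrict_scalars_simps [simp]: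
  "carrier (restrict_scalars A M) = carrier M"
  "\<zero>\<^bsub>restrict_scalars A M\<^esub> = \<zero>\<^bsub>M\<^esub>"
  "x \<oplus>\<^bsub>restrict_scalars A M\<^esub> y = x \<oplus>\<^bsub>M\<^esub> y"
  "k \<odot>\<^bsub>restrict_scalars A M\<^esub> x = (k \<odot>\<^bsub>A\<^esub> \<one>\<^bsub>A\<^esub>) \<odot>\<^bsub>M\<^esub> x"
  by (simp_all add: restrict_scalars_def)

context fin_dim_algebra
begin

lemma scalar_mult:
  assumes "k \<in> carrier K" and "a \<in> carrier A"
  shows "(k \<odot>\<^bsub>A\<^esub> \<one>\<^bsub>A\<^esub>) \<otimes>\<^bsub>A\<^esub> a = k \<odot>\<^bsub>A\<^esub> a" and "a \<otimes>\<^bsub>A\<^esub> (k \<odot>\<^bsub>A\<^esub> \<one>\<^bsub>A\<^esub>) = k \<odot>\<^bsub>A\<^esub> a"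
  using assms by (simp_all add: smult_mult_left smult_mult_right)

lemma left_module_algebra: "left_module K A"
  by (intro left_module.intro left_module_axioms.intro K.ring_axioms A.is_abelian_group)
    (auto simp: KA.smult_l_distr KA.smult_r_distr KA.smult_assoc1)

lemma left_module_restrict_scalars:
  assumes "left_module A M"
  shows "left_module K (restrict_scalars A M)"
proof -
  interpret M: left_module A M by fact
  have "abelian_group (restrict_scalars A M)"
  proof (rule abelian_groupI)
    fix x assume "x \<in> carrier (restrict_scalars A M)"
    then show "\<exists>y\<in>carrier (restrict_scalars A M). y \<oplus>\<^bsub>restrict_scalars A M\<^esub> x = \<zero>\<^bsub>restrict_scalars A M\<^esub>"
      by (intro bexI[of _ "\<ominus>\<^bsub>M\<^esub> x"]) (auto simp: M.M.l_neg)
  qed (auto simp: M.M.a_ac)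
  moreover have "((k \<otimes>\<^bsub>K\<^esub> l) \<odot>\<^bsub>A\<^esub> \<one>\<^bsub>A\<^esub>) = (k \<odot>\<^bsub>A\<^esub> \<one>\<^bsub>A\<^esub>) \<otimes>\<^bsub>A\<^esub> (l \<odot>\<^bsub>A\<^esub> \<one>\<^bsub>A\<^esub>)"
    if "k \<in> carrier K" "l \<in> carrier K" for k l
    using that by (simp add: scalar_mult(1) KA.smult_assoc1)
  ultimately show ?thesis
    by (intro left_module.intro left_module_axioms.intro K.ring_axioms)
      (auto simp: KA.smult_l_distr M.lsmult_l_distr M.lsmult_r_distr M.lsmult_assoc)
qed

lemma submodule_restrict_scalars:
  assumes "left_module A M" and U: "submodule U A M"
  shows "submodule U K (restrict_scalars A M)"
proof -
  interpret M: left_module K "restrict_scalars A M" by (rule left_module_restrict_scalars) fact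
  show ?thesis
    using submoduleD[OF U] by (intro M.submoduleI) auto
qed

text \<open>
  If \<open>B\<close> spans \<open>A\<close> over the field and \<open>S\<close> generates \<open>M\<close>, the products \<open>b s\<close> span \<open>M\<close>: a subspace
  that contains them contains every orbit \<open>A s\<close>.
\<close>

lemma fin_gen_restrict_scalars:
  assumes "left_module A M" and "fin_gen A M"
  shows "fin_gen K (restrict_scalars A M)"
proof -
  interpret M: left_module A M by fact
  let ?M = "restrict_scalars A M"
  have lM: "left_module K ?M" by (rule left_module_restrict_scalars[OF assms(1)])
  obtain S where S: "finite S" "S \<subseteq> carrier M" "carrier M \<subseteq> lspan A M S"
    using assms(2) unfolding fin_gen_iff_lspan[OF assms(1)] by blast
  obtain B where B: "finite B" "B \<subseteq> carrier A" "carrier A \<subseteq> lspan K A B"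
    using fin_dim unfolding fin_gen_iff_lspan[OF left_module_algebra] by blast
  let ?G = "(\<lambda>(b, s). b \<odot>\<^bsub>M\<^esub> s) ` (B \<times> S)"
  have G: "?G \<subseteq> carrier ?M" using B(2) S(2) by auto
  let ?L = "lspan K ?M ?G"
  have subL: "submodule ?L K ?M" by (rule submodule_lspan[OF lM G])
  note L = submoduleD[OF subL, simplified]
  have orbit: "a \<odot>\<^bsub>M\<^esub> s \<in> ?L" if a: "a \<in> carrier A" and s: "s \<in> S" for a s
  proof -
    have s': "s \<in> carrier M" using s S(2) by blast
    have "(\<lambda>a. a \<odot>\<^bsub>M\<^esub> s) \<in> mod_hom K A ?M"
    proof (rule mod_homI)
      fix k a assume k: "k \<in> carrier K" and a: "a \<in> carrier A"
      then show "(k \<odot>\<^bsub>A\<^esub> a) \<odot>\<^bsub>M\<^esub> s = k \<odot>\<^bsub>?M\<^esub> (a \<odot>\<^bsub>M\<^esub> s)"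
        using s' by (simp add: M.lsmult_assoc[symmetric] scalar_mult)
    qed (use s' in \<open>auto simp: M.lsmult_l_distr\<close>)
    then have "submodule {a \<in> carrier A. a \<odot>\<^bsub>M\<^esub> s \<in> ?L} K A"
      by (rule submodule_preimage[OF left_module_algebra lM _ subL])
    moreover have "B \<subseteq> {a \<in> carrier A. a \<odot>\<^bsub>M\<^esub> s \<in> ?L}"
      using B(2) s lspan_superset[of ?G K ?M] by fastforce
    ultimately show ?thesis using lspan_least[of _ K A B] B(3) a by blast
  qed
  \<comment> \<open>the span \<open>?L\<close> is only a subspace; this is the largest \<open>A\<close>-submodule inside it\<close>
  have "submodule {x \<in> carrier M. \<forall>a \<in> carrier A. a \<odot>\<^bsub>M\<^esub> x \<in> ?L} A M"
    using L by (intro M.submoduleI) (auto simp: M.lsmult_r_distr M.lsmult_assoc[symmetric])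
  moreover have "S \<subseteq> {x \<in> carrier M. \<forall>a \<in> carrier A. a \<odot>\<^bsub>M\<^esub> x \<in> ?L}"
    using orbit S(2) by blast
  ultimately have "carrier M \<subseteq> {x \<in> carrier M. \<forall>a \<in> carrier A. a \<odot>\<^bsub>M\<^esub> x \<in> ?L}"
    by (rule subset_trans[OF S(3) lspan_least])
  then have "\<one>\<^bsub>A\<^esub> \<odot>\<^bsub>M\<^esub> x \<in> ?L" if "x \<in> carrier M" for x using that A.one_closed by blast
  then have "carrier ?M \<subseteq> ?L" by auto
  then show ?thesis
    unfolding fin_gen_iff_lspan[OF lM] using G B(1) S(1) by (intro exI[of _ ?G]) auto
qed

text \<open>
  Over the ground field a submodule is a subspace of a finite dimensional space, and a finite
  spanning set of it generates it over \<open>A\<close> as well.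
\<close>

lemma fin_gen_submodule:
  assumes "left_module A M" and "fin_gen A M" and U: "submodule U A M"
  shows "fin_gen A (M\<lparr>carrier := U\<rparr>)"
proof -
  let ?M = "restrict_scalars A M" and ?U = "M\<lparr>carrier := U\<rparr>"
  have lM: "left_module K ?M" by (rule left_module_restrict_scalars[OF assms(1)])
  have lU: "left_module A ?U" by (rule left_module_submodule[OF assms(1) U])
  obtain S where S: "finite S" "S \<subseteq> carrier ?M" "carrier ?M \<subseteq> lspan K ?M S"
    using fin_gen_restrict_scalars[OF assms(1,2)] unfolding fin_gen_iff_lspan[OF lM] by blast
  have "U \<subseteq> lspan K ?M S" using submoduleD(1)[OF U] S(3) by simp
  then obtain T where T: "finite T" "T \<subseteq> U" "U \<subseteq> lspan K ?M T"
    using subspace_fin_gen[OF K.field_axioms lM S(1,2) submodule_restrict_scalars[OF assms(1) U]]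
    by blast
  have "submodule (lspan A ?U T) A ?U" using T(2) by (intro submodule_lspan[OF lU]) simp
  then have "submodule (lspan A ?U T) K ?M"
    by (intro submodule_restrict_scalars submodule_submodule[OF _ U] assms(1))
  then have "lspan K ?M T \<subseteq> lspan A ?U T" by (rule lspan_least[OF _ lspan_superset])
  then show ?thesis
    unfolding fin_gen_iff_lspan[OF lU] using T by (intro exI[of _ T]) auto
qed

lemma submodule_generators:
  assumes "left_module A M" and "fin_gen A M" and U: "submodule U A M"
  shows "\<exists>n x. x ` {..<n::nat} \<subseteq> U \<and> U \<subseteq> lspan A M (x ` {..<n})"
proof -
  let ?U = "M\<lparr>carrier := U\<rparr>"
  obtain S where S: "finite S" "S \<subseteq> U" "U \<subseteq> lspan A ?U S"
    using fin_gen_submodule[OF assms]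
    unfolding fin_gen_iff_lspan[OF left_module_submodule[OF assms(1) U]] by auto
  obtain n x where "S = x ` {i. i < (n::nat)}"
    using finite_imp_nat_seg_image_inj_on[OF S(1)] by metis
  then have nx: "S = x ` {..<n}" by (simp add: lessThan_def)
  have "U \<subseteq> lspan A M S"
    using S(3) lspan_submodule[OF assms(1) U S(2)] by (rule subset_trans)
  then show ?thesis using S(2) unfolding nx by blast
qed

end


section \<open>Traces\<close>

text \<open>
  For finitely generated \<open>M\<close> and \<open>\<X> = {Q}\<close> this is the largest submodule of \<open>M\<close> in
  \<open>Fac Q\<close>, and for a torsion class \<open>\<X>\<close> it is the torsion submodule of \<open>M\<close>.
\<close>

definition trace ::
    "('a, 'c) ring_scheme \<Rightarrow> ('a, 'n, 'e) module_scheme set \<Rightarrow> ('a, 'm, 'd) module_scheme \<Rightarrow> 'm set"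
  where "trace R \<X> M = lspan R M (\<Union>X\<in>\<X>. \<Union>f\<in>mod_hom R X M. f ` carrier X)"

lemma submodule_trace: "left_module R M \<Longrightarrow> submodule (trace R \<X> M) R M"
  unfolding trace_def by (rule submodule_lspan) (auto simp: mod_homD)

lemma image_in_trace: "\<lbrakk>X \<in> \<X>; f \<in> mod_hom R X M; x \<in> carrier X\<rbrakk> \<Longrightarrow> f x \<in> trace R \<X> M"
  unfolding trace_def by (rule subsetD[OF lspan_superset]) blast

lemma trace_least:
  assumes "submodule U R M"
    and "\<And>X f x. \<lbrakk>X \<in> \<X>; f \<in> mod_hom R X M; x \<in> carrier X\<rbrakk> \<Longrightarrow> f x \<in> U"
  shows "trace R \<X> M \<subseteq> U"
  unfolding trace_def using assms by (intro lspan_least) auto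

text \<open>
  The homomorphism \<open>A \<rightarrow> Q\<^sup>n\<close> with \<open>1 \<mapsto> q\<close> is a left \<open>Fac Q\<close>-approximation of \<open>A\<close>.  Take for the
  components of \<open>q\<close> a spanning set of \<open>Q\<close> over the ground field.  Scalars act on \<open>Q\<close> by
  endomorphisms, so every element of \<open>Q\<close> is the image of \<open>q\<close> under a homomorphism \<open>Q\<^sup>n \<rightarrow> Q\<close>.
  Therefore the images of \<open>q\<close> in \<open>X\<close> contain the image of every homomorphism \<open>Q \<rightarrow> X\<close>; and they form a
  submodule, since \<open>a q\<close> is the image of \<open>q\<close> under an endomorphism of \<open>Q\<^sup>n\<close>, found componentwise.
\<close>

lemma (in fin_dim_algebra) trace_approximation:
  fixes Q :: "('a, 'm, 'e) module_scheme"
  assumes "left_module A Q" and "fin_gen A Q"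
  obtains n q where "q \<in> carrier (copower_module n Q)"
    and "\<And>(X :: ('a, 'n, 'f) module_scheme) x. \<lbrakk>left_module A X; x \<in> trace A {Q} X\<rbrakk> \<Longrightarrow>
      \<exists>\<Phi> \<in> mod_hom A (copower_module n Q) X. \<Phi> q = x"
proof -
  interpret Q: left_module A Q by fact
  let ?Q = "restrict_scalars A Q"
  have lQ: "left_module K ?Q" by (rule left_module_restrict_scalars[OF assms(1)])
  interpret KQ: left_module K ?Q by (rule lQ)
  obtain S where S: "finite S" "S \<subseteq> carrier Q" "carrier Q \<subseteq> lspan K ?Q S"
    using fin_gen_restrict_scalars[OF assms] unfolding fin_gen_iff_lspan[OF lQ] by auto
  obtain h where h: "bij_betw h {0..<card S} S"
    using ex_bij_betw_nat_finite[OF S(1)] by blast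
  define n where "n = card S"
  define q where "q = (\<lambda>i\<in>{..<n}. h i)"
  let ?P = "copower_module n Q"
  have hS: "h i \<in> S" if "i < n" for i
    using bij_betwE[OF h] that by (simp add: n_def)
  have q: "q \<in> carrier ?P"
    using hS S(2) by (auto simp: q_def copower_module_simps)
  define E where "E = {y \<in> carrier Q. \<exists>\<psi> \<in> mod_hom A ?P Q. \<psi> q = y}"
  have "submodule E K ?Q"
  proof (rule KQ.submoduleI)
    show "\<zero>\<^bsub>?Q\<^esub> \<in> E"
      using mod_hom_const_zero[OF assms(1), of ?P] by (force simp: E_def)
    show "x \<oplus>\<^bsub>?Q\<^esub> y \<in> E" if "x \<in> E" "y \<in> E" for x y
      using that by (auto simp: E_def intro!: bexI[OF _ mod_hom_add[OF assms(1)]])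
    show "k \<odot>\<^bsub>?Q\<^esub> x \<in> E" if k: "k \<in> carrier K" and x: "x \<in> E" for k x
    proof -
      let ?k = "k \<odot>\<^bsub>A\<^esub> \<one>\<^bsub>A\<^esub>"
      obtain \<psi> where \<psi>: "\<psi> \<in> mod_hom A ?P Q" "\<psi> q = x" using x by (auto simp: E_def)
      have "(\<lambda>x. ?k \<odot>\<^bsub>Q\<^esub> x) \<in> mod_hom A Q Q"
        using k by (intro mod_homI)
          (auto simp: Q.lsmult_r_distr Q.lsmult_assoc[symmetric] scalar_mult)
      then show ?thesis
        using x k \<psi>(2) by (auto simp: E_def intro!: bexI[OF _ mod_hom_compose[OF \<psi>(1)]])
    qed
  qed (auto simp: E_def)
  moreover have "S \<subseteq> E"
  proof
    fix s assume s: "s \<in> S"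
    then have "s \<in> h ` {0..<card S}" using h by (simp add: bij_betw_def)
    then obtain i where "i < n" "s = h i" by (auto simp: n_def)
    then show "s \<in> E"
      using s S(2) bexI[OF _ copower_proj_hom[of i n A Q], of "\<lambda>\<psi>. \<psi> q = s"]
      by (auto simp: E_def q_def)
  qed
  ultimately have QE: "carrier Q \<subseteq> E" by (rule subset_trans[OF S(3) lspan_least])
  have "\<exists>\<Phi> \<in> mod_hom A ?P X. \<Phi> q = x"
    if lX: "left_module A X" and x: "x \<in> trace A {Q} X" for X :: "('a, 'n, 'f) module_scheme" and x
  proof -
    interpret X: left_module A X by (rule lX)
    define V where "V = {x. \<exists>\<Phi> \<in> mod_hom A ?P X. \<Phi> q = x}"
    have "submodule V A X"
    proof (rule X.submoduleI)
      show "V \<subseteq> carrier X" using q by (auto simp: V_def mod_homD)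
      show "\<zero>\<^bsub>X\<^esub> \<in> V"
        using mod_hom_const_zero[OF lX, of ?P] by (force simp: V_def)
      show "x \<oplus>\<^bsub>X\<^esub> y \<in> V" if "x \<in> V" "y \<in> V" for x y
        using that by (auto simp: V_def intro!: bexI[OF _ mod_hom_add[OF lX]])
      show "a \<odot>\<^bsub>X\<^esub> x \<in> V" if a: "a \<in> carrier A" and "x \<in> V" for a x
      proof -
        obtain \<Phi> where \<Phi>: "\<Phi> \<in> mod_hom A ?P X" "\<Phi> q = x" using \<open>x \<in> V\<close> by (auto simp: V_def)
        have qi: "q i \<in> carrier Q" if "i < n" for i using q that by (auto simp: copower_module_simps)
        have "\<exists>\<psi> \<in> mod_hom A ?P Q. \<psi> q = a \<odot>\<^bsub>Q\<^esub> q i" if "i < n" for i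
          using QE Q.lsmult_closed[OF a qi[OF that]] by (auto simp: E_def)
        then obtain \<psi> where \<psi>: "\<And>i. i < n \<Longrightarrow> \<psi> i \<in> mod_hom A ?P Q"
          "\<And>i. i < n \<Longrightarrow> \<psi> i q = a \<odot>\<^bsub>Q\<^esub> q i" by metis
        have "(\<lambda>i\<in>{..<n}. \<psi> i q) = a \<odot>\<^bsub>?P\<^esub> q"
          using \<psi>(2) by (auto simp: copower_module_simps)
        then have "\<Phi> (\<lambda>i\<in>{..<n}. \<psi> i q) = a \<odot>\<^bsub>X\<^esub> x"
          using mod_homD(3)[OF \<Phi>(1) a q] \<Phi>(2) by simp
        moreover have "(\<lambda>x. \<Phi> (\<lambda>i\<in>{..<n}. \<psi> i x)) \<in> mod_hom A ?P X"
          by (rule mod_hom_compose[OF copower_tuple_hom \<Phi>(1)]) (rule \<psi>(1))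
        ultimately show ?thesis
          unfolding V_def by (intro CollectI bexI[of _ "\<lambda>x. \<Phi> (\<lambda>i\<in>{..<n}. \<psi> i x)"])
      qed
    qed
    moreover have "f y \<in> V" if f: "f \<in> mod_hom A Q X" and y: "y \<in> carrier Q" for f y
    proof -
      obtain \<psi> where "\<psi> \<in> mod_hom A ?P Q" "\<psi> q = y" using QE y by (auto simp: E_def)
      then show ?thesis
        unfolding V_def by (intro CollectI bexI[of _ "\<lambda>x. f (\<psi> x)"] mod_hom_compose[of \<psi> _ _ Q f] f)
          simp_all
    qed
    ultimately have "trace A {Q} X \<subseteq> V" by (intro trace_least) auto
    then show ?thesis using x by (auto simp: V_def)
  qed
  then show thesis using that q by blast
qed

section \<open>Factor modules of direct sums of \<open>Q\<close>\<close>

lemma mod_catD: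
  assumes "M \<in> mod_cat A"
  shows "left_module A M" and "fin_gen A M"
  using assms by (simp_all add: mod_cat_def)

context fin_dim_algebra
begin

text \<open>
  A homomorphism from a quotient of \<open>Q\<^sup>n\<close> is determined by its composites with the \<open>n\<close> maps from
  \<open>Q\<close>.
\<close>

lemma Fac_hom_vanishes:
  assumes "left_module A Q" and X: "X \<in> Fac A Q" and "left_module A N" and van: "hom_vanishes A Q N"
  shows "hom_vanishes A X N"
  unfolding hom_vanishes_def
proof (intro ballI)
  obtain n U where U: "submodule U A (copower_module n Q)"
    and "mod_iso A (quotient_module (copower_module n Q) U) X"
    using X unfolding Fac_def by blast
  then obtain \<theta> where \<theta>: "\<theta> \<in> mod_hom A (quotient_module (copower_module n Q) U) X"
    and bij: "bij_betw \<theta> (carrier (quotient_module (copower_module n Q) U)) (carrier X)"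
    unfolding mod_iso_def by blast
  note c = quotient_module_facts[OF left_module_copower[OF assms(1)] U]
  fix f x assume f: "f \<in> mod_hom A X N" and x: "x \<in> carrier X"
  have "x \<in> \<theta> ` (\<lambda>z. U +>\<^bsub>copower_module n Q\<^esub> z) ` carrier (copower_module n Q)"
    using x bij c(3) by (simp add: bij_betw_def)
  then obtain z where z: "z \<in> carrier (copower_module n Q)" "x = \<theta> (U +>\<^bsub>copower_module n Q\<^esub> z)"
    by blast
  show "f x = \<zero>\<^bsub>N\<^esub>"
    unfolding z(2)
    by (rule hom_vanishesD[OF hom_vanishes_copower[OF assms(1,3) van]
          mod_hom_compose[OF mod_hom_compose[OF c(2) \<theta>] f] z(1)])
qed

text \<open>
  Each of the finitely many generators of \<open>X\<close> is the image of the element \<open>q \<in> Q\<^sup>m\<close> from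
  \<open>trace_approximation\<close>, so \<open>X\<close> is a quotient of a direct sum of copies of \<open>Q\<^sup>m\<close>.
\<close>

lemma trace_full_in_Fac:
  assumes Q: "Q \<in> mod_cat A" and X: "X \<in> mod_cat A" and full: "carrier X \<subseteq> trace A {Q} X"
  shows "X \<in> Fac A Q"
proof -
  note lQ = mod_catD(1)[OF Q] and lX = mod_catD(1)[OF X]
  interpret X: left_module A X by (rule lX)
  obtain m q where q: "q \<in> carrier (copower_module m Q)"
    and approx: "\<And>(X :: ('a, nat \<Rightarrow> 'a) module) x. \<lbrakk>left_module A X; x \<in> trace A {Q} X\<rbrakk> \<Longrightarrow>
      \<exists>\<Phi> \<in> mod_hom A (copower_module m Q) X. \<Phi> q = x"
    using trace_approximation[OF mod_catD[OF Q]] by metis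
  obtain s x where xs: "x ` {..<s::nat} \<subseteq> carrier X" and gen: "carrier X \<subseteq> lspan A X (x ` {..<s})"
    using submodule_generators[OF mod_catD[OF X] X.submodule_carrier] by blast
  have x: "x j \<in> carrier X" if "j < s" for j using xs that by blast
  have "\<exists>\<Phi> \<in> mod_hom A (copower_module m Q) X. \<Phi> q = x j" if "j < s" for j
    using approx[OF lX subsetD[OF full x[OF that]]] .
  then obtain \<Phi> where \<Phi>: "\<And>j. j < s \<Longrightarrow> \<Phi> j \<in> mod_hom A (copower_module m Q) X"
    "\<And>j. j < s \<Longrightarrow> \<Phi> j q = x j"
    by metis
  let ?P = "copower_module (s * m) Q"
  note lP = left_module_copower[OF lQ, of "s * m"]
  \<comment> \<open>\<open>(Q\<^sup>m)\<^sup>s\<close> is flattened to \<open>Q\<^bsup>s m\<^esup>\<close>: the pair of indices \<open>(j, i)\<close> becomes \<open>k = j m + i\<close>\<close>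
  have "(\<lambda>y. \<Phi> (k div m) (copower_inj m Q (k mod m) y)) \<in> mod_hom A Q X" if "k < s * m" for k
    using that by (intro mod_hom_compose[OF copower_inj_hom[OF lQ]] \<Phi>(1))
      (simp add: less_mult_imp_div_less)
  then obtain \<Psi> where \<Psi>: "\<Psi> \<in> mod_hom A ?P X"
    and \<Psi>_inj: "\<And>k y. \<lbrakk>k < s * m; y \<in> carrier Q\<rbrakk> \<Longrightarrow>
      \<Psi> (copower_inj (s * m) Q k y) = \<Phi> (k div m) (copower_inj m Q (k mod m) y)"
    using copower_hom_ex[OF lQ lX, of "s * m" "\<lambda>k y. \<Phi> (k div m) (copower_inj m Q (k mod m) y)"]
    by metis
  interpret P: left_module A ?P by (rule lP)
  let ?I = "\<Psi> ` carrier ?P"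
  have subI: "submodule ?I A X" by (rule submodule_image[OF lP lX \<Psi> P.submodule_carrier])
  have "x j \<in> ?I" if j: "j < s" for j
  proof -
    have "copower_inj m Q i y \<in> {z \<in> carrier (copower_module m Q). \<Phi> j z \<in> ?I}"
      if i: "i < m" and y: "y \<in> carrier Q" for i y
    proof -
      have k: "j * m + i < s * m"
      proof -
        have "j * m + i < Suc j * m" using i by simp
        also have "\<dots> \<le> s * m" using j by (intro mult_le_mono1) simp
        finally show ?thesis .
      qed
      have "\<Psi> (copower_inj (s * m) Q (j * m + i) y) = \<Phi> j (copower_inj m Q i y)"
        using \<Psi>_inj[OF k y] i by simp
      then have "\<Phi> j (copower_inj m Q i y) \<in> ?I"
        by (metis imageI mod_homD(1)[OF copower_inj_hom[OF lQ] y])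
      then show ?thesis using mod_homD(1)[OF copower_inj_hom[OF lQ] y] by simp
    qed
    then have "carrier (copower_module m Q) \<subseteq> {z \<in> carrier (copower_module m Q). \<Phi> j z \<in> ?I}"
      by (intro copower_submodule_eq[OF lQ]
          submodule_preimage[OF left_module_copower[OF lQ] lX \<Phi>(1)[OF j] subI])
    from subsetD[OF this q] have "\<Phi> j q \<in> ?I" by simp
    then show ?thesis unfolding \<Phi>(2)[OF j] .
  qed
  then have "lspan A X (x ` {..<s}) \<subseteq> ?I" by (intro lspan_least[OF subI]) auto
  then have surj: "\<Psi> ` carrier ?P = carrier X"
    using subset_trans[OF gen] submoduleD(1)[OF subI] by (intro subset_antisym)
  define U where "U = {z \<in> carrier ?P. \<Psi> z = \<zero>\<^bsub>X\<^esub>}"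
  have U: "submodule U A ?P" unfolding U_def by (rule submodule_kernel[OF lP lX \<Psi>])
  note c = quotient_module_facts[OF lP U]
  obtain h where h: "h \<in> mod_hom A (quotient_module ?P U) X"
    and hc: "\<And>z. z \<in> carrier ?P \<Longrightarrow> h (U +>\<^bsub>?P\<^esub> z) = \<Psi> z"
    using mod_hom_factor_surj[OF lP c(1) lX c(2,3) \<Psi>] c(4) by (auto simp: U_def)
  have "inj_on h (carrier (quotient_module ?P U))"
  proof (rule mod_hom_injI[OF c(1) lX h])
    fix C assume C: "C \<in> carrier (quotient_module ?P U)" "h C = \<zero>\<^bsub>X\<^esub>"
    then obtain z where z: "z \<in> carrier ?P" "C = U +>\<^bsub>?P\<^esub> z" unfolding c(3)[symmetric] by blast
    then have "z \<in> U" using C(2) hc[OF z(1)] by (simp add: U_def)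
    then show "C = \<zero>\<^bsub>quotient_module ?P U\<^esub>" unfolding z(2) by (simp only: c(4)[OF z(1)])
  qed
  moreover have "h ` carrier (quotient_module ?P U) = carrier X"
    unfolding c(3)[symmetric] surj[symmetric] image_image using hc by (rule image_cong[OF refl])
  ultimately have "mod_iso A (quotient_module ?P U) X"
    unfolding mod_iso_def using h by (auto simp: bij_betw_def)
  then show ?thesis using U X unfolding Fac_def by blast
qed

text \<open>
  A homomorphism \<open>Q \<rightarrow> Z\<close> lifts along the surjection \<open>X \<rightarrow> Z\<close>, and the image of the lift lies in the
  trace, which is killed.
\<close>

lemma hom_from_projective_vanishes:
  assumes "projective_mod A Q" and X: "X \<in> mod_cat A" and Z: "Z \<in> mod_cat A"
    and p: "p \<in> mod_hom A X Z" and surj: "p ` carrier X = carrier Z"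
    and ker: "\<And>x. x \<in> trace A {Q} X \<Longrightarrow> p x = \<zero>\<^bsub>Z\<^esub>"
  shows "hom_vanishes A Q Z"
  unfolding hom_vanishes_def
proof (intro ballI)
  fix f y assume f: "f \<in> mod_hom A Q Z" and y: "y \<in> carrier Q"
  obtain g where "g \<in> mod_hom A Q X" "\<And>x. x \<in> carrier Q \<Longrightarrow> p (g x) = f x"
    using assms(1) X Z p f surj unfolding projective_mod_def by metis
  then show "f y = \<zero>\<^bsub>Z\<^esub>" using ker[OF image_in_trace[of Q "{Q}" g A X y]] y by simp
qed

end

section \<open>The torsion pair\<close>

definition left_perp ::
    "('a, 'c) ring_scheme \<Rightarrow> ('a, nat \<Rightarrow> 'a) module set \<Rightarrow> ('a, nat \<Rightarrow> 'a) module set"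
  where "left_perp A \<F> = {X \<in> mod_cat A. \<forall>Y \<in> \<F>. hom_vanishes A X Y}"

lemma left_perpD:
  assumes "X \<in> left_perp A \<F>"
  shows "X \<in> mod_cat A"
    and "\<And>N f x. \<lbrakk>N \<in> \<F>; f \<in> mod_hom A X N; x \<in> carrier X\<rbrakk> \<Longrightarrow> f x = \<zero>\<^bsub>N\<^esub>"
  using assms by (auto simp: left_perp_def hom_vanishes_def)

lemma left_perpI:
  assumes "X \<in> mod_cat A"
    and "\<And>N f x. \<lbrakk>N \<in> \<F>; f \<in> mod_hom A X N; x \<in> carrier X\<rbrakk> \<Longrightarrow> f x = \<zero>\<^bsub>N\<^esub>"
  shows "X \<in> left_perp A \<F>"
  using assms by (auto simp: left_perp_def hom_vanishes_def)

locale projective_with_torsion_pair = fin_dim_algebra K A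
  for K :: "('k, 'c) ring_scheme" and A :: "('k, 'a, 'd) module_scheme" +
  fixes Q :: "('a, nat \<Rightarrow> 'a) module" and \<TT> \<FF> :: "('a, nat \<Rightarrow> 'a) module set"
  assumes Q: "Q \<in> mod_cat A"
    and projective: "projective_mod A Q"
    and pair: "torsion_pair A \<TT> \<FF>"
begin

lemma torsion_eq: "\<TT> = left_perp A \<FF>"
  unfolding left_perp_def by (rule conjunct1[OF pair[unfolded torsion_pair_def]])

lemma torsion_free_iff:
  "Y \<in> \<FF> \<longleftrightarrow> Y \<in> mod_cat A \<and> (\<forall>X \<in> \<TT>. \<forall>f \<in> mod_hom A X Y. \<forall>x \<in> carrier X. f x = \<zero>\<^bsub>Y\<^esub>)"
  using pair unfolding torsion_pair_def hom_vanishes_def by blast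

lemma torsion_freeD:
  assumes "Y \<in> \<FF>"
  shows "Y \<in> mod_cat A"
    and "\<And>X f x. \<lbrakk>X \<in> \<TT>; f \<in> mod_hom A X Y; x \<in> carrier X\<rbrakk> \<Longrightarrow> f x = \<zero>\<^bsub>Y\<^esub>"
  using assms unfolding torsion_free_iff by simp_all

lemma Fac_star_subset_left_perp:
  "star_product A (Fac A Q) \<TT> \<subseteq> left_perp A (\<FF> \<inter> right_perp A Q)"
proof
  fix Y assume "Y \<in> star_product A (Fac A Q) \<TT>"
  then obtain X Z f g where Y: "Y \<in> mod_cat A" and X: "X \<in> Fac A Q" and Z: "Z \<in> \<TT>"
    and f: "f \<in> mod_hom A X Y" and g: "g \<in> mod_hom A Y Z" and ex: "short_exact X Y Z f g"
    unfolding star_product_def by blast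
  have Z': "Z \<in> mod_cat A" using Z left_perpD(1) unfolding torsion_eq by blast
  show "Y \<in> left_perp A (\<FF> \<inter> right_perp A Q)"
  proof (rule left_perpI[OF Y])
    fix N h y assume N: "N \<in> \<FF> \<inter> right_perp A Q" and h: "h \<in> mod_hom A Y N" and y: "y \<in> carrier Y"
    have N': "N \<in> mod_cat A" and van: "hom_vanishes A Q N" using N by (auto simp: right_perp_def)
    have vanX: "hom_vanishes A X N"
      by (rule Fac_hom_vanishes[OF mod_catD(1)[OF Q] X mod_catD(1)[OF N'] van])
    have ker: "h z = \<zero>\<^bsub>N\<^esub>" if "z \<in> carrier Y" "g z = \<zero>\<^bsub>Z\<^esub>" for z
    proof -
      have "z \<in> f ` carrier X" using that ex by (auto simp: short_exact_def a_kernel_def')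
      then obtain x where x: "x \<in> carrier X" "z = f x" by blast
      show ?thesis unfolding x(2) by (rule hom_vanishesD[OF vanX mod_hom_compose[OF f h] x(1)])
    qed
    have "g ` carrier Y = carrier Z" using ex by (simp add: short_exact_def)
    then obtain k where k: "k \<in> mod_hom A Z N" "\<And>z. z \<in> carrier Y \<Longrightarrow> k (g z) = h z"
      using mod_hom_factor_surj[OF mod_catD(1)[OF Y] mod_catD(1)[OF Z'] mod_catD(1)[OF N'] g _ h ker]
      by blast
    have "k (g y) = \<zero>\<^bsub>N\<^esub>"
      using Z N k(1) mod_homD(1)[OF g y] left_perpD(2)[of Z A \<FF> N k] unfolding torsion_eq by blast
    then show "h y = \<zero>\<^bsub>N\<^esub>" using k(2)[OF y] by simp
  qed
qed

text \<open>
  Let \<open>I\<close> be the image of a homomorphism from \<open>Z\<close> to a torsion-free module \<open>N\<close>.  As a submodule of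
  \<open>N\<close> it is torsion-free, and as a quotient of \<open>X\<close> in which the trace of \<open>Q\<close> vanishes it lies in
  \<open>Q\<^sup>\<bottom>\<close>.  So \<open>X\<close>, which maps onto \<open>I\<close>, has only zero homomorphisms to it.
\<close>

lemma quotient_by_trace_torsion:
  assumes X: "X \<in> left_perp A (\<FF> \<inter> right_perp A Q)" and Z: "Z \<in> mod_cat A"
    and p: "p \<in> mod_hom A X Z" and surj: "p ` carrier X = carrier Z"
    and ker: "\<And>x. x \<in> trace A {Q} X \<Longrightarrow> p x = \<zero>\<^bsub>Z\<^esub>"
  shows "Z \<in> \<TT>"
  unfolding torsion_eq
proof (rule left_perpI[OF Z])
  note X' = left_perpD(1)[OF X]
  note lX = mod_catD(1)[OF X'] and lZ = mod_catD(1)[OF Z]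
  interpret Z: left_module A Z by (rule lZ)
  fix N h z assume N: "N \<in> \<FF>" and h: "h \<in> mod_hom A Z N" and z: "z \<in> carrier Z"
  have N': "N \<in> mod_cat A" using N torsion_free_iff by blast
  note lN = mod_catD(1)[OF N']
  have sub: "submodule (h ` carrier Z) A N"
    by (rule submodule_image[OF lZ lN h Z.submodule_carrier])
  obtain I i where I: "I \<in> mod_cat A" and i: "i \<in> mod_hom A I N"
    and inj: "inj_on i (carrier I)" and img: "i ` carrier I = h ` carrier Z"
    using submodule_object[OF lN sub fin_gen_submodule[OF mod_catD[OF N'] sub]] by metis
  note lI = mod_catD(1)[OF I]
  have i_zero: "y = \<zero>\<^bsub>I\<^esub>" if "y \<in> carrier I" "i y = \<zero>\<^bsub>N\<^esub>" for y
  proof -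
    interpret I: left_module A I by (rule lI)
    show ?thesis
      by (rule inj_onD[OF inj _ that(1) I.M.zero_closed]) (simp add: that(2) mod_hom_zero[OF lI lN i])
  qed
  obtain k where k: "k \<in> mod_hom A Z I" and ik: "\<And>z. z \<in> carrier Z \<Longrightarrow> i (k z) = h z"
    using mod_hom_factor_inj[OF lZ lI lN i inj h] img by blast
  have k_surj: "k ` carrier Z = carrier I"
  proof
    show "k ` carrier Z \<subseteq> carrier I" using mod_homD(1)[OF k] by auto
    show "carrier I \<subseteq> k ` carrier Z"
    proof
      fix y assume y: "y \<in> carrier I"
      have "i y \<in> h ` carrier Z" unfolding img[symmetric] using y by (rule imageI)
      then obtain w where w: "w \<in> carrier Z" "i y = h w" by blast
      have "y = k w"
        by (rule inj_onD[OF inj _ y mod_homD(1)[OF k w(1)]]) (simp add: w(2) ik[OF w(1)])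
      then show "y \<in> k ` carrier Z" using w(1) by (rule image_eqI)
    qed
  qed
  note kp = mod_hom_compose[OF p k]
  have "I \<in> \<FF>"
    unfolding torsion_free_iff
  proof (intro conjI ballI I)
    fix Y f y assume Y: "Y \<in> \<TT>" and f: "f \<in> mod_hom A Y I" and y: "y \<in> carrier Y"
    have "i (f y) = \<zero>\<^bsub>N\<^esub>" by (rule torsion_freeD(2)[OF N Y mod_hom_compose[OF f i] y])
    then show "f y = \<zero>\<^bsub>I\<^esub>" by (rule i_zero[OF mod_homD(1)[OF f y]])
  qed
  moreover have "I \<in> right_perp A Q"
  proof -
    have "(\<lambda>x. k (p x)) ` carrier X = carrier I" using surj k_surj by (metis image_image)
    moreover have "k (p x) = \<zero>\<^bsub>I\<^esub>" if "x \<in> trace A {Q} X" for x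
      using ker[OF that] mod_hom_zero[OF lZ lI k] by simp
    ultimately show ?thesis
      using hom_from_projective_vanishes[OF projective X' I kp] I by (simp add: right_perp_def)
  qed
  moreover obtain x where x: "x \<in> carrier X" "z = p x" using z unfolding surj[symmetric] by blast
  ultimately have "k z = \<zero>\<^bsub>I\<^esub>" using left_perpD(2)[OF X _ kp x(1)] by simp
  then show "h z = \<zero>\<^bsub>N\<^esub>" using ik[OF z] mod_hom_zero[OF lI lN i] by simp
qed

text \<open>
  The required exact sequence is \<open>0 \<rightarrow> trace \<rightarrow> Y \<rightarrow> Y / trace \<rightarrow> 0\<close>.  The copy \<open>X\<close> of the trace is its
  own trace, because every homomorphism \<open>Q \<rightarrow> Y\<close> factors through the inclusion of \<open>X\<close>.
\<close>

lemma left_perp_subset_Fac_star: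
  "left_perp A (\<FF> \<inter> right_perp A Q) \<subseteq> star_product A (Fac A Q) (\<TT> \<inter> right_perp A Q)"
proof
  fix Y assume Y: "Y \<in> left_perp A (\<FF> \<inter> right_perp A Q)"
  note Y' = left_perpD(1)[OF Y]
  note lY = mod_catD(1)[OF Y']
  note tr = submodule_trace[OF lY, of "{Q}"]
  obtain X i where X: "X \<in> mod_cat A" and i: "i \<in> mod_hom A X Y"
    and inj: "inj_on i (carrier X)" and img: "i ` carrier X = trace A {Q} Y"
    using submodule_object[OF lY tr fin_gen_submodule[OF mod_catD[OF Y'] tr]] by metis
  obtain Z p where Z: "Z \<in> mod_cat A" and p: "p \<in> mod_hom A Y Z" and surj: "p ` carrier Y = carrier Z"
    and ker: "\<And>y. y \<in> carrier Y \<Longrightarrow> p y = \<zero>\<^bsub>Z\<^esub> \<longleftrightarrow> y \<in> trace A {Q} Y"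
    using quotient_object[OF mod_catD[OF Y'] tr] by metis
  have ker': "p y = \<zero>\<^bsub>Z\<^esub>" if "y \<in> trace A {Q} Y" for y
    using ker[OF submoduleD(2)[OF tr that]] that by simp
  note lX = mod_catD(1)[OF X]
  have "X \<in> Fac A Q"
  proof (rule trace_full_in_Fac[OF Q X])
    have "trace A {Q} Y \<subseteq> i ` trace A {Q} X"
    proof (rule trace_least[OF submodule_image[OF lX lY i submodule_trace[OF lX]]])
      fix P f x assume P: "P \<in> {Q}" and f: "f \<in> mod_hom A P Y" and x: "x \<in> carrier P"
      have "f ` carrier P \<subseteq> i ` carrier X" using image_in_trace[OF P f] unfolding img by auto
      then obtain g where g: "g \<in> mod_hom A P X" "\<And>x. x \<in> carrier P \<Longrightarrow> i (g x) = f x"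
        using mod_hom_factor_inj[OF _ lX lY i inj f] P mod_catD(1)[OF Q] by blast
      then show "f x \<in> i ` trace A {Q} X"
        using image_in_trace[OF P g(1) x] by (metis imageI x)
    qed
    then have *: "i ` carrier X \<subseteq> i ` trace A {Q} X" unfolding img .
    show "carrier X \<subseteq> trace A {Q} X"
    proof
      fix x assume x: "x \<in> carrier X"
      then have "i x \<in> i ` trace A {Q} X" using * by blast
      then obtain y where y: "y \<in> trace A {Q} X" "i x = i y" by blast
      have "x = y" by (rule inj_onD[OF inj y(2) x submoduleD(2)[OF submodule_trace[OF lX] y(1)]])
      then show "x \<in> trace A {Q} X" using y(1) by simp
    qed
  qed
  moreover have "Z \<in> \<TT>" by (rule quotient_by_trace_torsion[OF Y Z p surj ker'])
  moreover have "Z \<in> right_perp A Q"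
    using hom_from_projective_vanishes[OF projective Y' Z p surj ker'] Z by (simp add: right_perp_def)
  moreover have "short_exact X Y Z i p"
    using inj img surj ker submoduleD(2)[OF tr] by (auto simp: short_exact_def a_kernel_def')
  ultimately show "Y \<in> star_product A (Fac A Q) (\<TT> \<inter> right_perp A Q)"
    using Y' i p unfolding star_product_def by blast
qed

text \<open>
  The class contains \<open>Q\<close> and \<open>\<TT>\<close>, so a module that receives only zero homomorphisms from it lies in
  \<open>Q\<^sup>\<bottom>\<close> and in \<open>\<FF>\<close>.
\<close>

lemma torsion_pair_left_perp:
  "torsion_pair A (left_perp A (\<FF> \<inter> right_perp A Q)) (\<FF> \<inter> right_perp A Q)"
proof -
  have "Q \<in> left_perp A (\<FF> \<inter> right_perp A Q)"
    using Q by (auto simp: left_perp_def right_perp_def)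
  moreover have "\<TT> \<subseteq> left_perp A (\<FF> \<inter> right_perp A Q)"
    unfolding torsion_eq by (auto simp: left_perp_def)
  ultimately have "{Y \<in> mod_cat A. \<forall>X \<in> left_perp A (\<FF> \<inter> right_perp A Q). hom_vanishes A X Y}
      \<subseteq> \<FF> \<inter> right_perp A Q"
    unfolding right_perp_def using torsion_free_iff by (auto simp: hom_vanishes_def subset_iff)
  moreover have "\<FF> \<inter> right_perp A Q
      \<subseteq> {Y \<in> mod_cat A. \<forall>X \<in> left_perp A (\<FF> \<inter> right_perp A Q). hom_vanishes A X Y}"
    by (auto simp: left_perp_def right_perp_def)
  ultimately show ?thesis
    unfolding torsion_pair_def by (simp add: left_perp_def subset_antisym)
qed

end

section \<open>Approximations\<close>

text \<open>
  The trace in \<open>M\<close> of the class itself is the right approximation of \<open>M\<close>.  It belongs to the class: a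
  homomorphism from it to a member of \<open>\<F>\<close> vanishes on the images that span it.
\<close>

lemma (in fin_dim_algebra) contravariantly_finite_left_perp:
  assumes F: "\<F> \<subseteq> mod_cat A"
  shows "contravariantly_finite A (left_perp A \<F>)"
  unfolding contravariantly_finite_def
proof
  fix M :: "('a, nat \<Rightarrow> 'a) module"
  assume M: "M \<in> mod_cat A"
  let ?W = "left_perp A \<F>"
  note lM = mod_catD(1)[OF M]
  note tr = submodule_trace[OF lM, of ?W]
  obtain X i where X: "X \<in> mod_cat A" and i: "i \<in> mod_hom A X M"
    and inj: "inj_on i (carrier X)" and img: "i ` carrier X = trace A ?W M"
    using submodule_object[OF lM tr fin_gen_submodule[OF mod_catD[OF M] tr]] by metis
  note lX = mod_catD(1)[OF X]
  have lift: "\<exists>h \<in> mod_hom A X' X. \<forall>x \<in> carrier X'. i (h x) = g x"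
    if X': "X' \<in> ?W" and g: "g \<in> mod_hom A X' M" for X' g
  proof (rule mod_hom_factor_inj[OF mod_catD(1)[OF left_perpD(1)[OF X']] lX lM i inj g])
    show "g ` carrier X' \<subseteq> i ` carrier X" using image_in_trace[OF X' g] unfolding img by auto
  qed
  have "X \<in> ?W"
  proof (rule left_perpI[OF X])
    fix N f x assume N: "N \<in> \<F>" and f: "f \<in> mod_hom A X N" and x: "x \<in> carrier X"
    have lN: "left_module A N" using N F mod_catD(1) by blast
    let ?K = "{x \<in> carrier X. f x = \<zero>\<^bsub>N\<^esub>}"
    have "trace A ?W M \<subseteq> i ` ?K"
    proof (rule trace_least[OF submodule_image[OF lX lM i submodule_kernel[OF lX lN f]]])
      fix X' g y assume X': "X' \<in> ?W" and g: "g \<in> mod_hom A X' M" and y: "y \<in> carrier X'"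
      obtain h where h: "h \<in> mod_hom A X' X" "i (h y) = g y" using lift[OF X' g] y by blast
      have "f (h y) = \<zero>\<^bsub>N\<^esub>" by (rule left_perpD(2)[OF X' N mod_hom_compose[OF h(1) f] y])
      then have "h y \<in> ?K" using mod_homD(1)[OF h(1) y] by simp
      then show "g y \<in> i ` ?K" unfolding h(2)[symmetric] by (rule imageI)
    qed
    then have "i x \<in> i ` ?K" using x img by blast
    then obtain y where y: "y \<in> carrier X" "f y = \<zero>\<^bsub>N\<^esub>" "i x = i y" by blast
    have "x = y" by (rule inj_onD[OF inj y(3) x y(1)])
    then show "f x = \<zero>\<^bsub>N\<^esub>" using y(2) by simp
  qed
  then show "\<exists>X \<in> ?W. \<exists>f \<in> mod_hom A X M. \<forall>X' \<in> ?W. \<forall>g \<in> mod_hom A X' M.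
      \<exists>h \<in> mod_hom A X' X. \<forall>x \<in> carrier X'. f (h x) = g x"
    using i lift by blast
qed

lemma (in fin_dim_algebra) free_hom_ex:
  assumes "left_module A M" and x: "\<And>i. i < r \<Longrightarrow> x i \<in> carrier M"
  shows "\<exists>\<phi> \<in> mod_hom A (copower_module r (regular_module A)) M. \<forall>i<r. \<forall>a \<in> carrier A.
    \<phi> (copower_inj r (regular_module A) i a) = a \<odot>\<^bsub>M\<^esub> x i"
proof -
  have "(\<lambda>a. a \<odot>\<^bsub>M\<^esub> x i) \<in> mod_hom A (regular_module A) M" if "i < r" for i
    by (rule regular_module_hom[OF assms(1) x[OF that]])
  then obtain \<phi> where "\<phi> \<in> mod_hom A (copower_module r (regular_module A)) M"
    "\<And>i a. \<lbrakk>i < r; a \<in> carrier (regular_module A)\<rbrakk> \<Longrightarrow>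
      \<phi> (copower_inj r (regular_module A) i a) = a \<odot>\<^bsub>M\<^esub> x i"
    using copower_hom_ex[OF left_module_regular[OF A.ring_axioms] assms(1), of r "\<lambda>i a. a \<odot>\<^bsub>M\<^esub> x i"]
    by metis
  then show ?thesis by auto
qed

text \<open>
  The module \<open>E\<close> that approximates \<open>M\<close> is the pushout of \<open>B = M \<oplus> A\<^sup>r\<close> and a left
  \<open>Fac Q\<close>-approximation of \<open>L = ker (B \<rightarrow> T)\<close> along \<open>L\<close>.  Both constructions are merged into one
  quotient of \<open>D = B \<oplus> P\<^sup>s\<close>, where \<open>P = Q\<^sup>m\<close> contains the element \<open>q\<close> of \<open>trace_approximation\<close>: it
  identifies each generator \<open>l\<^sub>j\<close> of \<open>L\<close>, up to sign, with the copy of \<open>q\<close> in the summand \<open>j\<close> of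
  \<open>P\<^sup>s\<close>.
\<close>

lemma (in projective_with_torsion_pair) covariantly_finite_left_perp:
  assumes cov: "covariantly_finite A \<TT>"
  shows "covariantly_finite A (left_perp A (\<FF> \<inter> right_perp A Q))"
  unfolding covariantly_finite_def
proof
  fix M :: "('a, nat \<Rightarrow> 'a) module"
  assume M: "M \<in> mod_cat A"
  let ?W = "left_perp A (\<FF> \<inter> right_perp A Q)"
  note lM = mod_catD(1)[OF M] and lQ = mod_catD(1)[OF Q]
  interpret M: left_module A M by (rule lM)
  obtain T \<alpha> where T: "T \<in> \<TT>" and \<alpha>: "\<alpha> \<in> mod_hom A M T"
    and univ: "\<And>Z g. \<lbrakk>Z \<in> \<TT>; g \<in> mod_hom A M Z\<rbrakk> \<Longrightarrow>
      \<exists>h \<in> mod_hom A T Z. \<forall>x \<in> carrier M. h (\<alpha> x) = g x"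
    using cov M unfolding covariantly_finite_def by metis
  have T': "T \<in> mod_cat A" using T left_perpD(1) unfolding torsion_eq by blast
  note lT = mod_catD(1)[OF T']
  interpret T: left_module A T by (rule lT)
  obtain r t where t': "t ` {..<r::nat} \<subseteq> carrier T" and Tgen: "carrier T \<subseteq> lspan A T (t ` {..<r})"
    using submodule_generators[OF mod_catD[OF T'] T.submodule_carrier] by blast
  have t: "t k \<in> carrier T" if "k < r" for k using t' that by blast
  let ?R = "regular_module A"
  let ?F = "copower_module r ?R" and ?e = "\<lambda>k. copower_inj r ?R k"
  have lR: "left_module A ?R" by (rule left_module_regular[OF A.ring_axioms])
  have lF: "left_module A ?F" by (rule left_module_copower[OF lR])
  interpret F: left_module A ?F by (rule lF)
  have e: "?e k a \<in> carrier ?F" if "a \<in> carrier A" for k a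
    using mod_homD(1)[OF copower_inj_hom[OF lR]] that by simp
  obtain \<beta>' where \<beta>': "\<beta>' \<in> mod_hom A ?F T"
    and \<beta>'_e: "\<And>k a. \<lbrakk>k < r; a \<in> carrier A\<rbrakk> \<Longrightarrow> \<beta>' (?e k a) = a \<odot>\<^bsub>T\<^esub> t k"
    using free_hom_ex[OF lT, of r t] t by blast
  let ?B = "prod_module M ?F"
  have lB: "left_module A ?B" by (rule left_module_prod[OF lM lF])
  interpret B: left_module A ?B by (rule lB)
  have fgB: "fin_gen A ?B"
    by (intro fin_gen_prod lM lF mod_catD(2)[OF M] fin_gen_copower lR fin_gen_regular A.ring_axioms)
  define \<beta> where "\<beta> = (\<lambda>b. \<alpha> (fst b) \<oplus>\<^bsub>T\<^esub> \<beta>' (snd b))"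
  have \<beta>: "\<beta> \<in> mod_hom A ?B T" unfolding \<beta>_def by (rule prod_case_hom[OF lT \<alpha> \<beta>'])
  have \<beta>_surj: "\<beta> ` carrier ?B = carrier T"
  proof
    show "\<beta> ` carrier ?B \<subseteq> carrier T" using mod_homD(1)[OF \<beta>] by auto
    have "t k \<in> \<beta> ` carrier ?B" if k: "k < r" for k
    proof -
      have "\<beta> (\<zero>\<^bsub>M\<^esub>, ?e k \<one>\<^bsub>A\<^esub>) = t k"
        using mod_hom_zero[OF lM lT \<alpha>] \<beta>'_e[OF k A.one_closed] t[OF k] by (simp add: \<beta>_def)
      then show ?thesis
        using e[OF A.one_closed] by (intro image_eqI[of _ _ "(\<zero>\<^bsub>M\<^esub>, ?e k \<one>\<^bsub>A\<^esub>)"]) auto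
    qed
    then have "lspan A T (t ` {..<r}) \<subseteq> \<beta> ` carrier ?B"
      by (intro lspan_least submodule_image[OF lB lT \<beta> B.submodule_carrier]) auto
    then show "carrier T \<subseteq> \<beta> ` carrier ?B" by (rule subset_trans[OF Tgen])
  qed
  define L where "L = {b \<in> carrier ?B. \<beta> b = \<zero>\<^bsub>T\<^esub>}"
  have subL: "submodule L A ?B" unfolding L_def by (rule submodule_kernel[OF lB lT \<beta>])
  obtain s l where l': "l ` {..<s::nat} \<subseteq> L" and Lgen: "L \<subseteq> lspan A ?B (l ` {..<s})"
    using submodule_generators[OF lB fgB subL] by blast
  have l: "l j \<in> L" "l j \<in> carrier ?B" "\<beta> (l j) = \<zero>\<^bsub>T\<^esub>" if "j < s" for j
    using l' that unfolding L_def by blast+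
  obtain m q where q: "q \<in> carrier (copower_module m Q)"
    and approx: "\<And>(X :: ('a, nat \<Rightarrow> 'a) module) x. \<lbrakk>left_module A X; x \<in> trace A {Q} X\<rbrakk> \<Longrightarrow>
      \<exists>\<Phi> \<in> mod_hom A (copower_module m Q) X. \<Phi> q = x"
    using trace_approximation[OF mod_catD[OF Q]] by metis
  let ?P = "copower_module m Q"
  let ?S = "copower_module s ?P"
  have lP: "left_module A ?P" by (rule left_module_copower[OF lQ])
  have lS: "left_module A ?S" by (rule left_module_copower[OF lP])
  interpret S: left_module A ?S by (rule lS)
  let ?D = "prod_module ?B ?S"
  have lD: "left_module A ?D" by (rule left_module_prod[OF lB lS])
  have fgD: "fin_gen A ?D"
    by (intro fin_gen_prod lB lS fgB fin_gen_copower lP lQ mod_catD(2)[OF Q])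
  let ?j = "\<lambda>j. copower_inj s ?P j q"
  have jS: "?j j \<in> carrier ?S" for j by (rule mod_homD(1)[OF copower_inj_hom[OF lP] q])
  define u where "u = (\<lambda>j. (l j, ?j j))"
  have uD: "u ` {..<s} \<subseteq> carrier ?D"
    unfolding u_def prod_module_simps(1)[of ?B ?S] using l(2) jS by blast
  define U where "U = lspan A ?D (u ` {..<s})"
  have subU: "submodule U A ?D" unfolding U_def by (rule submodule_lspan[OF lD uD])
  have uU: "u j \<in> U" if "j < s" for j
    unfolding U_def by (rule subsetD[OF lspan_superset]) (use that in simp)
  obtain E \<pi> where E: "E \<in> mod_cat A" and \<pi>: "\<pi> \<in> mod_hom A ?D E"
    and \<pi>_surj: "\<pi> ` carrier ?D = carrier E"
    and \<pi>_ker: "\<And>x. x \<in> carrier ?D \<Longrightarrow> \<pi> x = \<zero>\<^bsub>E\<^esub> \<longleftrightarrow> x \<in> U"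
    using quotient_object[OF lD fgD subU] by metis
  note lE = mod_catD(1)[OF E]
  have inl: "(\<lambda>b. (b, \<zero>\<^bsub>?S\<^esub>)) \<in> mod_hom A ?B ?D" by (rule prod_inl_hom[OF lS])
  have inr: "(\<lambda>y. (\<zero>\<^bsub>?B\<^esub>, y)) \<in> mod_hom A ?S ?D" by (rule prod_inr_hom[OF lB])
  have inM: "(\<lambda>x. (x, \<zero>\<^bsub>?F\<^esub>)) \<in> mod_hom A M ?B" by (rule prod_inl_hom[OF lF])
  define f where "f = (\<lambda>x. \<pi> ((x, \<zero>\<^bsub>?F\<^esub>), \<zero>\<^bsub>?S\<^esub>))"
  have f: "f \<in> mod_hom A M E"
    unfolding f_def by (rule mod_hom_compose[OF mod_hom_compose[OF inM inl] \<pi>])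
  \<comment> \<open>a homomorphism from \<open>E\<close> to \<open>N\<close> kills \<open>P\<^sup>s\<close> since \<open>N \<in> Q\<^sup>\<bottom>\<close>, hence kills \<open>L\<close> by the relations
    \<open>u j = 0\<close>, hence factors through \<open>B / L = T\<close> and is zero since \<open>N\<close> is torsion-free\<close>
  have "E \<in> ?W"
  proof (rule left_perpI[OF E])
    fix N c z assume N: "N \<in> \<FF> \<inter> right_perp A Q" and c: "c \<in> mod_hom A E N" and z: "z \<in> carrier E"
    have NF: "N \<in> \<FF>" and van: "hom_vanishes A Q N" using N by (auto simp: right_perp_def)
    note lN = mod_catD(1)[OF torsion_freeD(1)[OF NF]]
    interpret N: left_module A N by (rule lN)
    define k where "k = (\<lambda>d. c (\<pi> d))"
    have k: "k \<in> mod_hom A ?D N" unfolding k_def by (rule mod_hom_compose[OF \<pi> c])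
    note kinl = mod_hom_compose[OF inl k] and kinr = mod_hom_compose[OF inr k]
    have k_add: "k (b, y) = k (b, \<zero>\<^bsub>?S\<^esub>) \<oplus>\<^bsub>N\<^esub> k (\<zero>\<^bsub>?B\<^esub>, y)"
      if "b \<in> carrier ?B" "y \<in> carrier ?S" for b y
    proof -
      have "k ((b, \<zero>\<^bsub>?S\<^esub>) \<oplus>\<^bsub>?D\<^esub> (\<zero>\<^bsub>?B\<^esub>, y)) = k (b, \<zero>\<^bsub>?S\<^esub>) \<oplus>\<^bsub>N\<^esub> k (\<zero>\<^bsub>?B\<^esub>, y)"
        by (rule mod_homD(2)[OF k mod_homD(1)[OF inl that(1)] mod_homD(1)[OF inr that(2)]])
      moreover have "(b, \<zero>\<^bsub>?S\<^esub>) \<oplus>\<^bsub>?D\<^esub> (\<zero>\<^bsub>?B\<^esub>, y) = (b, y)"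
        unfolding prod_module_simps(3)[of ?B ?S] fst_conv snd_conv
        using B.M.r_zero[OF that(1)] S.M.l_zero[OF that(2)] by simp
      ultimately show ?thesis by simp
    qed
    have k_right: "k (\<zero>\<^bsub>?B\<^esub>, y) = \<zero>\<^bsub>N\<^esub>" if "y \<in> carrier ?S" for y
      by (rule hom_vanishesD[OF hom_vanishes_copower[OF lP lN hom_vanishes_copower[OF lQ lN van]]
            kinr that])
    have "k (l j, \<zero>\<^bsub>?S\<^esub>) = \<zero>\<^bsub>N\<^esub>" if j: "j < s" for j
    proof -
      have "\<pi> (u j) = \<zero>\<^bsub>E\<^esub>" using \<pi>_ker uU[OF j] submoduleD(2)[OF subU] by blast
      then have "k (u j) = \<zero>\<^bsub>N\<^esub>" using mod_hom_zero[OF lE lN c] by (simp add: k_def)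
      then have "k (l j, \<zero>\<^bsub>?S\<^esub>) \<oplus>\<^bsub>N\<^esub> \<zero>\<^bsub>N\<^esub> = \<zero>\<^bsub>N\<^esub>"
        using k_add[OF l(2)[OF j] jS] k_right[OF jS] by (simp only: u_def)
      then show ?thesis using mod_homD(1)[OF kinl l(2)[OF j]] by (simp only: N.M.r_zero)
    qed
    then have "lspan A ?B (l ` {..<s}) \<subseteq> {b \<in> carrier ?B. k (b, \<zero>\<^bsub>?S\<^esub>) = \<zero>\<^bsub>N\<^esub>}"
      using l(2) by (intro lspan_least submodule_kernel[OF lB lN kinl]) blast
    then have "k (b, \<zero>\<^bsub>?S\<^esub>) = \<zero>\<^bsub>N\<^esub>" if "b \<in> carrier ?B" "\<beta> b = \<zero>\<^bsub>T\<^esub>" for b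
      using Lgen that unfolding L_def by blast
    then obtain h where h: "h \<in> mod_hom A T N"
      "\<And>b. b \<in> carrier ?B \<Longrightarrow> h (\<beta> b) = k (b, \<zero>\<^bsub>?S\<^esub>)"
      using mod_hom_factor_surj[OF lB lT lN \<beta> \<beta>_surj kinl] by blast
    have k_left: "k (b, \<zero>\<^bsub>?S\<^esub>) = \<zero>\<^bsub>N\<^esub>" if "b \<in> carrier ?B" for b
      unfolding h(2)[OF that, symmetric] by (rule torsion_freeD(2)[OF NF T h(1) mod_homD(1)[OF \<beta> that]])
    obtain d where d: "d \<in> carrier ?D" "z = \<pi> d" using z unfolding \<pi>_surj[symmetric] by blast
    obtain b y where bd: "d = (b, y)" "b \<in> carrier ?B" "y \<in> carrier ?S"
      using d(1) unfolding prod_module_simps(1)[of ?B ?S] by blast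
    have "k d = \<zero>\<^bsub>N\<^esub> \<oplus>\<^bsub>N\<^esub> \<zero>\<^bsub>N\<^esub>"
      unfolding bd(1) k_add[OF bd(2,3)] k_left[OF bd(2)] k_right[OF bd(3)] ..
    then show "c z = \<zero>\<^bsub>N\<^esub>" by (simp add: d(2) k_def)
  qed
  moreover have "\<exists>\<eta> \<in> mod_hom A E X. \<forall>x \<in> carrier M. \<eta> (f x) = g x"
    if X: "X \<in> ?W" and g: "g \<in> mod_hom A M X" for X g
  proof -
    note X' = left_perpD(1)[OF X]
    note lX = mod_catD(1)[OF X']
    interpret X: left_module A X by (rule lX)
    note tr = submodule_trace[OF lX, of "{Q}"]
    obtain Z p where Z: "Z \<in> mod_cat A" and p: "p \<in> mod_hom A X Z" and p_surj: "p ` carrier X = carrier Z"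
      and p_ker: "\<And>x. x \<in> carrier X \<Longrightarrow> p x = \<zero>\<^bsub>Z\<^esub> \<longleftrightarrow> x \<in> trace A {Q} X"
      using quotient_object[OF mod_catD[OF X'] tr] by metis
    note lZ = mod_catD(1)[OF Z]
    interpret Z: left_module A Z by (rule lZ)
    have "Z \<in> \<TT>"
      by (rule quotient_by_trace_torsion[OF X Z p p_surj]) (use p_ker submoduleD(2)[OF tr] in blast)
    then obtain h where h: "h \<in> mod_hom A T Z" and h\<alpha>: "\<And>x. x \<in> carrier M \<Longrightarrow> h (\<alpha> x) = p (g x)"
      using univ[OF _ mod_hom_compose[OF g p]] by blast
    \<comment> \<open>lifting \<open>h\<close> on the generators of \<open>T\<close> extends \<open>g\<close> to \<open>\<gamma>\<close> on \<open>B\<close> with \<open>p \<gamma> = h \<beta>\<close>\<close>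
    have "\<exists>x \<in> carrier X. p x = h (t k)" if k: "k < r" for k
    proof -
      have "h (t k) \<in> p ` carrier X" unfolding p_surj by (rule mod_homD(1)[OF h t[OF k]])
      then show ?thesis by (elim imageE) (rule bexI, simp_all)
    qed
    then obtain x where x: "\<And>k. k < r \<Longrightarrow> x k \<in> carrier X" and px: "\<And>k. k < r \<Longrightarrow> p (x k) = h (t k)"
      by metis
    obtain \<gamma>' where \<gamma>': "\<gamma>' \<in> mod_hom A ?F X"
      and \<gamma>'_e: "\<And>k a. \<lbrakk>k < r; a \<in> carrier A\<rbrakk> \<Longrightarrow> \<gamma>' (?e k a) = a \<odot>\<^bsub>X\<^esub> x k"
      using free_hom_ex[OF lX, of r x] x by blast
    have "carrier ?F \<subseteq> {a \<in> carrier ?F. p (\<gamma>' a) = h (\<beta>' a)}"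
    proof (rule copower_submodule_eq[OF lR])
      show "submodule {a \<in> carrier ?F. p (\<gamma>' a) = h (\<beta>' a)} A ?F"
        by (rule submodule_equalizer[OF lF lZ mod_hom_compose[OF \<gamma>' p] mod_hom_compose[OF \<beta>' h]])
      fix k a assume k: "k < r" and "a \<in> carrier ?R"
      then have a: "a \<in> carrier A" by simp
      have "p (\<gamma>' (?e k a)) = h (\<beta>' (?e k a))"
        using px[OF k] \<gamma>'_e[OF k a] \<beta>'_e[OF k a] mod_homD(3)[OF p a x[OF k]] mod_homD(3)[OF h a t[OF k]]
        by simp
      then show "?e k a \<in> {a \<in> carrier ?F. p (\<gamma>' a) = h (\<beta>' a)}" using e[OF a] by simp
    qed
    then have p\<gamma>': "p (\<gamma>' a) = h (\<beta>' a)" if "a \<in> carrier ?F" for a using that by blast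
    define \<gamma> where "\<gamma> = (\<lambda>b. g (fst b) \<oplus>\<^bsub>X\<^esub> \<gamma>' (snd b))"
    have \<gamma>: "\<gamma> \<in> mod_hom A ?B X" unfolding \<gamma>_def by (rule prod_case_hom[OF lX g \<gamma>'])
    have p\<gamma>: "p (\<gamma> b) = h (\<beta> b)" if "b \<in> carrier ?B" for b
    proof -
      have b: "fst b \<in> carrier M" "snd b \<in> carrier ?F"
        using that unfolding prod_module_simps(1) by (simp_all only: mem_Times_iff)
      show ?thesis
        unfolding \<gamma>_def \<beta>_def
          mod_homD(2)[OF p mod_homD(1)[OF g b(1)] mod_homD(1)[OF \<gamma>' b(2)]]
          mod_homD(2)[OF h mod_homD(1)[OF \<alpha> b(1)] mod_homD(1)[OF \<beta>' b(2)]]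
          h\<alpha>[OF b(1)] p\<gamma>'[OF b(2)] ..
    qed
    \<comment> \<open>\<open>\<gamma>\<close> maps \<open>L\<close> to the trace; the sign makes \<open>\<gamma>\<close> and these maps cancel on the relations \<open>u j\<close>\<close>
    have "\<exists>\<Phi> \<in> mod_hom A ?P X. \<Phi> q = \<ominus>\<^bsub>X\<^esub> \<gamma> (l j)" if j: "j < s" for j
    proof -
      have "p (\<gamma> (l j)) = \<zero>\<^bsub>Z\<^esub>" using p\<gamma>[OF l(2)[OF j]] l(3)[OF j] mod_hom_zero[OF lT lZ h] by simp
      then have "\<gamma> (l j) \<in> trace A {Q} X" using p_ker[OF mod_homD(1)[OF \<gamma> l(2)[OF j]]] by blast
      then show ?thesis by (intro approx[OF lX] submoduleD(6)[OF tr])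
    qed
    then obtain \<phi> where \<phi>: "\<And>j. j < s \<Longrightarrow> \<phi> j \<in> mod_hom A ?P X"
      and \<phi>q: "\<And>j. j < s \<Longrightarrow> \<phi> j q = \<ominus>\<^bsub>X\<^esub> \<gamma> (l j)"
      by metis
    obtain \<Phi> where \<Phi>: "\<Phi> \<in> mod_hom A ?S X"
      and \<Phi>_inj: "\<And>j y. \<lbrakk>j < s; y \<in> carrier ?P\<rbrakk> \<Longrightarrow> \<Phi> (copower_inj s ?P j y) = \<phi> j y"
      using copower_hom_ex[OF lP lX, of s \<phi>] \<phi> by metis
    define \<delta> where "\<delta> = (\<lambda>d. \<gamma> (fst d) \<oplus>\<^bsub>X\<^esub> \<Phi> (snd d))"
    have \<delta>: "\<delta> \<in> mod_hom A ?D X" unfolding \<delta>_def by (rule prod_case_hom[OF lX \<gamma> \<Phi>])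
    have "\<delta> (u j) = \<zero>\<^bsub>X\<^esub>" if j: "j < s" for j
    proof -
      have "\<delta> (u j) = \<gamma> (l j) \<oplus>\<^bsub>X\<^esub> \<ominus>\<^bsub>X\<^esub> \<gamma> (l j)"
        unfolding \<delta>_def u_def fst_conv snd_conv \<Phi>_inj[OF j q] \<phi>q[OF j] ..
      also have "\<dots> = \<zero>\<^bsub>X\<^esub>" by (rule X.M.r_neg[OF mod_homD(1)[OF \<gamma> l(2)[OF j]]])
      finally show ?thesis .
    qed
    then have "U \<subseteq> {d \<in> carrier ?D. \<delta> d = \<zero>\<^bsub>X\<^esub>}"
      unfolding U_def using uD by (intro lspan_least submodule_kernel[OF lD lX \<delta>]) blast
    then have "\<delta> d = \<zero>\<^bsub>X\<^esub>" if "d \<in> carrier ?D" "\<pi> d = \<zero>\<^bsub>E\<^esub>" for d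
      using \<pi>_ker[OF that(1)] that(2) by blast
    then obtain \<eta> where \<eta>: "\<eta> \<in> mod_hom A E X" "\<And>d. d \<in> carrier ?D \<Longrightarrow> \<eta> (\<pi> d) = \<delta> d"
      using mod_hom_factor_surj[OF lD lE lX \<pi> \<pi>_surj \<delta>] by blast
    have "\<eta> (f y) = g y" if y: "y \<in> carrier M" for y
    proof -
      have "\<eta> (f y) = \<delta> ((y, \<zero>\<^bsub>?F\<^esub>), \<zero>\<^bsub>?S\<^esub>)"
        unfolding f_def by (rule \<eta>(2)[OF mod_homD(1)[OF inl mod_homD(1)[OF inM y]]])
      also have "\<dots> = g y \<oplus>\<^bsub>X\<^esub> \<zero>\<^bsub>X\<^esub> \<oplus>\<^bsub>X\<^esub> \<zero>\<^bsub>X\<^esub>"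
        unfolding \<delta>_def \<gamma>_def fst_conv snd_conv mod_hom_zero[OF lF lX \<gamma>'] mod_hom_zero[OF lS lX \<Phi>] ..
      finally show ?thesis using mod_homD(1)[OF g y] by simp
    qed
    then show ?thesis using \<eta>(1) by blast
  qed
  ultimately show "\<exists>X \<in> ?W. \<exists>f \<in> mod_hom A M X. \<forall>X' \<in> ?W. \<forall>g \<in> mod_hom A M X'.
      \<exists>h \<in> mod_hom A X X'. \<forall>x \<in> carrier M. h (f x) = g x"
    using f by blast
qed

theorem proposition6p3p3:
  fixes K :: "('k, 'c) ring_scheme"
    and A :: "('k, 'a, 'd) module_scheme"
    and Q :: "('a, nat \<Rightarrow> 'a) module"
    and \<TT> :: "('a, nat \<Rightarrow> 'a) module set"
  assumes "fin_dim_algebra K A"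
    and "basic_algebra A"
    and "Q \<in> mod_cat A"
    and "projective_mod A Q"
    and "torsion_class A \<TT>"
    and "functorially_finite A \<TT>"
  shows "\<T>\<^sub>Q A Q \<TT> = star_product A (Fac A Q) (\<TT> \<inter> right_perp A Q)
    \<and> torsion_class A (\<T>\<^sub>Q A Q \<TT>)
    \<and> functorially_finite A (\<T>\<^sub>Q A Q \<TT>)"
proof -
  obtain \<FF> where "torsion_pair A \<TT> \<FF>"
    using assms(5) unfolding torsion_class_def by blast
  then interpret projective_with_torsion_pair K A Q \<TT> \<FF>
    using assms(1,3,4) by (simp add: projective_with_torsion_pair_def projective_with_torsion_pair_axioms_def)
  let ?W = "left_perp A (\<FF> \<inter> right_perp A Q)"
  have "star_product A (Fac A Q) (\<TT> \<inter> right_perp A Q) \<subseteq> star_product A (Fac A Q) \<TT>"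
    unfolding star_product_def by blast
  then have W: "\<T>\<^sub>Q A Q \<TT> = ?W" and star: "star_product A (Fac A Q) (\<TT> \<inter> right_perp A Q) = ?W"
    using Fac_star_subset_left_perp left_perp_subset_Fac_star unfolding \<T>\<^sub>Q_def by simp_all
  have "torsion_class A ?W"
    using torsion_pair_left_perp unfolding torsion_class_def by blast
  moreover have "functorially_finite A ?W"
    unfolding functorially_finite_def
  proof (intro conjI)
    show "?W \<subseteq> mod_cat A" using left_perpD(1) by blast
    show "contravariantly_finite A ?W"
      by (rule contravariantly_finite_left_perp) (auto simp: right_perp_def)
    show "covariantly_finite A ?W"
      using covariantly_finite_left_perp assms(6) unfolding functorially_finite_def by blast
  qed
  ultimately show ?thesis unfolding W star by simp
qed

end
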